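(* Let $\Gamma$ be a profinite group and let $\varepsilon\colon (F_1 \to G_1) \to (F_2 \to G_2)$ be a quasi-isomorphism of crossed modules with $\Gamma$-action. Then $\varepsilon$ induces bijections $$\varepsilon_*\colon \mathbf{H}^i(F_1 \to G_1) \longrightarrow \mathbf{H}^i(F_2 \to G_2)$$ for $i = -1, 0, 1$.
   Context: $\Gamma$ is a profinite group. A $\Gamma$-group is a (discrete, possibly non-abelian) group with a left action of $\Gamma$ by automorphisms, written $(\sigma,g)\mapsto {}^{\sigma}g$, such that the stabilizer of every element is open in $\Gamma$. For a $\Gamma$-group $F$, $\operatorname{Maps}(\Gamma,F)$ and $\operatorname{Maps}(\Gamma\times\Gamma,F)$ denote the sets of continuous maps ($F$ discrete). A crossed module is a group homomorphism $\alpha\colon F\to G$ with a left action of $G$ on $F$ by automorphisms, $(g,f)\mapsto{}^{g}f$, such that $ff'f^{-1}={}^{\alpha(f)}f'$ and $\alpha({}^{g}f)=g\,\alpha(f)\,g^{-1}$ for all $f,f'\in F$, $g\in G$. It has a $\Gamma$-action if $F$ and $G$ are $\Gamma$-groups, $\alpha({}^{\sigma}f)={}^{\sigma}(\alpha(f))$ and ${}^{\sigma}({}^{g}f)={}^{({}^{\sigma}g)}({}^{\sigma}f)$. Then $\operatorname{im}\alpha$ is normal in $G$, and $\operatorname{coker}\alpha=G/\operatorname{im}\alpha$ is a group. A morphism $\varepsilon\colon(F_1\xrightarrow{\alpha_1} G_1)\to(F_2\xrightarrow{\alpha_2} G_2)$ of crossed modules with $\Gamma$-action is a pair of $\Gamma$-equivariant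 homomorphisms $\varepsilon_{-1}\colon F_1\to F_2$, $\varepsilon_0\colon G_1\to G_2$ with $\alpha_2\varepsilon_{-1}=\varepsilon_0\alpha_1$ and $\varepsilon_{-1}({}^{g}f)={}^{\varepsilon_0(g)}\varepsilon_{-1}(f)$. It is a quasi-isomorphism if the induced homomorphisms $\ker\alpha_1\to\ker\alpha_2$ and $\operatorname{coker}\alpha_1\to\operatorname{coker}\alpha_2$ are isomorphisms. Hypercohomology of a crossed module $\alpha\colon F\to G$ with $\Gamma$-action: (a) $\mathbf{H}^{-1}(F\to G)=(\ker\alpha)^{\Gamma}$. (b) $Z^0$ is the set of pairs $(\varphi,g)\in\operatorname{Maps}(\Gamma,F)\times G$ with $\varphi(\sigma\tau)=\varphi(\sigma)\cdot{}^{\sigma}\varphi(\tau)$ and ${}^{\sigma}g=\alpha(\varphi(\sigma)^{-1})\cdot g$ for all $\sigma,\tau\in\Gamma$. The group $F$ acts on $Z^0$ on the right by $(\varphi,g)*f=(\varphi',g')$, $\varphi'(\sigma)=f^{-1}\varphi(\sigma)\,{}^{\sigma}f$, $g'=\alpha(f)^{-1}g$. Set $\mathbf{H}^0(F\to G)=Z^0/F$. (c) $C^0=\operatorname{Maps}(\Gamma,F)\times G$ with group law $(\varphi_1,g_1)(\varphi_2,g_2)=({}^{g_1}\varphi_2\cdot\varphi_1,\,g_1g_2)$. $Z^1$ is the set of pairs $(h,\psi)\in\operatorname{Maps}(\Gamma\times\Gamma,F)\times\operatorname{Maps}(\Gamma,G)$ such that for all $\sigma,\tau,\upsilon\in\Gamma$: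 $\psi(\sigma)\cdot{}^{\sigma}\psi(\tau)=\alpha(h(\sigma,\tau))^{-1}\cdot\psi(\sigma\tau)$ and $h(\sigma,\tau\upsilon)\cdot{}^{\psi(\sigma)\sigma}h(\tau,\upsilon)=h(\sigma\tau,\upsilon)\cdot h(\sigma,\tau)$, where ${}^{\psi(\sigma)\sigma}x={}^{\psi(\sigma)}({}^{\sigma}x)$. The group $C^0$ acts on $Z^1$ on the right by $(h,\psi)*(a,g)=(h',\psi')$, where $\psi'(\sigma)=g^{-1}\alpha(a(\sigma))\psi(\sigma)\,{}^{\sigma}g$ and $h'(\sigma,\tau)={}^{g^{-1}}\bigl[a(\sigma\tau)\,h(\sigma,\tau)\cdot{}^{\psi(\sigma)\sigma}a(\tau)^{-1}\cdot a(\sigma)^{-1}\bigr]$. Set $\mathbf{H}^1(F\to G)=Z^1/C^0$. The induced maps $\varepsilon_*$ are obtained by applying $\varepsilon_{-1}$ and $\varepsilon_0$ to cocycles. *)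

theory Defs
  imports "HOL-Analysis.Analysis" "HOL-Algebra.Coset" "HOL-Algebra.Bij" "HOL-Algebra.Group_Action"
begin

section \<open>Profinite groups and their actions\<close>

locale topological_group = group \<Gamma> for \<Gamma> :: "'s monoid" +
  fixes T :: "'s topology"
  assumes topspace_eq: "topspace T = carrier \<Gamma>"
    and continuous_mult: "continuous_map (prod_topology T T) T (\<lambda>(\<sigma>, \<tau>). \<sigma> \<otimes>\<^bsub>\<Gamma>\<^esub> \<tau>)"
    and continuous_inv: "continuous_map T T (\<lambda>\<sigma>. inv\<^bsub>\<Gamma>\<^esub> \<sigma>)"

locale profinite_group = topological_group \<Gamma> T for \<Gamma> :: "'s monoid" and T :: "'s topology" +
  assumes compact: "compact_space T"
    and Hausdorff: "Hausdorff_space T"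
    and totally_disconnected: "\<And>S \<sigma> \<tau>. \<lbrakk>connectedin T S; \<sigma> \<in> S; \<tau> \<in> S\<rbrakk> \<Longrightarrow> \<sigma> = \<tau>"

text \<open>A left action of \<open>H\<close> on \<open>A\<close> by automorphisms is a homomorphism from \<open>H\<close> to
  \<^const>\<open>AutoGroup\<close> \<open>A\<close>. The elements of \<^const>\<open>AutoGroup\<close> \<open>A\<close> are extensional functions on
  \<open>carrier A\<close>, which only fixes the irrelevant values outside \<open>A\<close>.\<close>

locale aut_action = H: group H + A: group A
  for H :: "'h monoid" and A :: "'a monoid" +
  fixes \<rho> :: "'h \<Rightarrow> 'a \<Rightarrow> 'a"
  assumes action_hom: "\<rho> \<in> hom H (AutoGroup A)"

locale discrete_Gamma_group = profinite_group \<Gamma> T + aut_action \<Gamma> A \<rho>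
  for \<Gamma> :: "'s monoid" and T :: "'s topology" and A :: "'a monoid" and \<rho> :: "'s \<Rightarrow> 'a \<Rightarrow> 'a" +
  assumes open_stabilizer: "\<And>a. a \<in> carrier A \<Longrightarrow> openin T (stabilizer \<Gamma> \<rho> a)"

text \<open>Continuous maps to a discrete group, made extensional so that two of them are equal as soon
  as they agree on the space.\<close>

definition cmaps :: "'x topology \<Rightarrow> 'a monoid \<Rightarrow> ('x \<Rightarrow> 'a) set" where
  "cmaps X A = {\<phi> \<in> extensional (topspace X). continuous_map X (discrete_topology (carrier A)) \<phi>}"

section \<open>Crossed modules with an action\<close>

text \<open>The data of a crossed module \<open>\<alpha> : F \<rightarrow> G\<close>, of the action of \<open>G\<close> on \<open>F\<close>, and of actions of a
  group with elements of type \<open>'s\<close> on \<open>F\<close> and on \<open>G\<close>.\<close>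

record ('s, 'f, 'g) xmod =
  src :: "'f monoid"
  tgt :: "'g monoid"
  bdry :: "'f \<Rightarrow> 'g"
  xact :: "'g \<Rightarrow> 'f \<Rightarrow> 'f"
  sact :: "'s \<Rightarrow> 'f \<Rightarrow> 'f"
  tact :: "'s \<Rightarrow> 'g \<Rightarrow> 'g"

locale crossed_module = aut_action "tgt X" "src X" "xact X"
  for X :: "('s, 'f, 'g) xmod" +
  assumes bdry_hom: "bdry X \<in> hom (src X) (tgt X)"
    and peiffer: "\<And>f f'. \<lbrakk>f \<in> carrier (src X); f' \<in> carrier (src X)\<rbrakk> \<Longrightarrow>
      f \<otimes>\<^bsub>src X\<^esub> f' \<otimes>\<^bsub>src X\<^esub> inv\<^bsub>src X\<^esub> f = xact X (bdry X f) f'"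
    and bdry_xact: "\<And>g f. \<lbrakk>g \<in> carrier (tgt X); f \<in> carrier (src X)\<rbrakk> \<Longrightarrow>
      bdry X (xact X g f) = g \<otimes>\<^bsub>tgt X\<^esub> bdry X f \<otimes>\<^bsub>tgt X\<^esub> inv\<^bsub>tgt X\<^esub> g"

locale Gamma_crossed_module = crossed_module X +
  src: discrete_Gamma_group \<Gamma> T "src X" "sact X" +
  tgt: discrete_Gamma_group \<Gamma> T "tgt X" "tact X"
  for \<Gamma> :: "'s monoid" and T :: "'s topology" and X :: "('s, 'f, 'g) xmod" +
  assumes bdry_equivariant: "\<And>\<sigma> f. \<lbrakk>\<sigma> \<in> carrier \<Gamma>; f \<in> carrier (src X)\<rbrakk> \<Longrightarrow>
      bdry X (sact X \<sigma> f) = tact X \<sigma> (bdry X f)"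
    and xact_equivariant: "\<And>\<sigma> g f. \<lbrakk>\<sigma> \<in> carrier \<Gamma>; g \<in> carrier (tgt X); f \<in> carrier (src X)\<rbrakk> \<Longrightarrow>
      sact X \<sigma> (xact X g f) = xact X (tact X \<sigma> g) (sact X \<sigma> f)"

text \<open>Below, \<open>e\<close> is the component \<open>F\<^sub>1 \<rightarrow> F\<^sub>2\<close> of a morphism and \<open>e'\<close> its component
  \<open>G\<^sub>1 \<rightarrow> G\<^sub>2\<close>.\<close>

locale Gamma_xmod_morphism =
  X: Gamma_crossed_module \<Gamma> T X + Y: Gamma_crossed_module \<Gamma> T Y
  for \<Gamma> :: "'s monoid" and T :: "'s topology"
    and X :: "('s, 'f1, 'g1) xmod" and Y :: "('s, 'f2, 'g2) xmod" +
  fixes e :: "'f1 \<Rightarrow> 'f2" and e' :: "'g1 \<Rightarrow> 'g2"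
  assumes src_hom: "e \<in> hom (src X) (src Y)"
    and tgt_hom: "e' \<in> hom (tgt X) (tgt Y)"
    and src_equivariant: "\<And>\<sigma> f. \<lbrakk>\<sigma> \<in> carrier \<Gamma>; f \<in> carrier (src X)\<rbrakk> \<Longrightarrow>
      e (sact X \<sigma> f) = sact Y \<sigma> (e f)"
    and tgt_equivariant: "\<And>\<sigma> g. \<lbrakk>\<sigma> \<in> carrier \<Gamma>; g \<in> carrier (tgt X)\<rbrakk> \<Longrightarrow>
      e' (tact X \<sigma> g) = tact Y \<sigma> (e' g)"
    and square: "\<And>f. f \<in> carrier (src X) \<Longrightarrow> bdry Y (e f) = e' (bdry X f)"
    and xact_compat: "\<And>g f. \<lbrakk>g \<in> carrier (tgt X); f \<in> carrier (src X)\<rbrakk> \<Longrightarrow>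
      e (xact X g f) = xact Y (e' g) (e f)"

definition ker_bdry :: "('s, 'f, 'g) xmod \<Rightarrow> 'f monoid" where
  "ker_bdry X = (src X)\<lparr>carrier := kernel (src X) (tgt X) (bdry X)\<rparr>"

definition im_bdry :: "('s, 'f, 'g) xmod \<Rightarrow> 'g set" where
  "im_bdry X = bdry X ` carrier (src X)"

definition coker_bdry :: "('s, 'f, 'g) xmod \<Rightarrow> 'g set monoid" where
  "coker_bdry X = tgt X Mod im_bdry X"

text \<open>For a morphism, the cosets of \<open>e' g\<close> for \<open>g\<close> in a given coset of \<^term>\<open>im_bdry X\<close> all
  coincide; their union is this common coset.\<close>

definition coker_map :: "('s, 'f2, 'g2) xmod \<Rightarrow> ('g1 \<Rightarrow> 'g2) \<Rightarrow> 'g1 set \<Rightarrow> 'g2 set" where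
  "coker_map Y e' C = (\<Union>g\<in>C. im_bdry Y #>\<^bsub>tgt Y\<^esub> e' g)"

locale Gamma_xmod_quasi_iso = Gamma_xmod_morphism +
  assumes ker_iso: "e \<in> iso (ker_bdry X) (ker_bdry Y)"
    and coker_iso: "coker_map Y e' \<in> iso (coker_bdry X) (coker_bdry Y)"

section \<open>Hypercohomology\<close>

definition Hm1 :: "'s monoid \<Rightarrow> ('s, 'f, 'g) xmod \<Rightarrow> 'f set" where
  "Hm1 \<Gamma> X = {f \<in> carrier (ker_bdry X). \<forall>\<sigma>\<in>carrier \<Gamma>. sact X \<sigma> f = f}"

definition Z0 :: "'s monoid \<Rightarrow> 's topology \<Rightarrow> ('s, 'f, 'g) xmod \<Rightarrow> (('s \<Rightarrow> 'f) \<times> 'g) set" where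
  "Z0 \<Gamma> T X = {(\<phi>, g). \<phi> \<in> cmaps T (src X) \<and> g \<in> carrier (tgt X) \<and>
     (\<forall>\<sigma>\<in>carrier \<Gamma>. \<forall>\<tau>\<in>carrier \<Gamma>. \<phi> (\<sigma> \<otimes>\<^bsub>\<Gamma>\<^esub> \<tau>) = \<phi> \<sigma> \<otimes>\<^bsub>src X\<^esub> sact X \<sigma> (\<phi> \<tau>)) \<and>
     (\<forall>\<sigma>\<in>carrier \<Gamma>. tact X \<sigma> g = bdry X (inv\<^bsub>src X\<^esub> (\<phi> \<sigma>)) \<otimes>\<^bsub>tgt X\<^esub> g)}"

text \<open>The actions on cocycles are right actions; following the argument order of \<^const>\<open>orbit\<close>,
  the acting element is written first.\<close>

definition Z0_act :: "'s monoid \<Rightarrow> ('s, 'f, 'g) xmod \<Rightarrow>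
    'f \<Rightarrow> ('s \<Rightarrow> 'f) \<times> 'g \<Rightarrow> ('s \<Rightarrow> 'f) \<times> 'g" where
  "Z0_act \<Gamma> X f = (\<lambda>(\<phi>, g).
     (\<lambda>\<sigma>\<in>carrier \<Gamma>. inv\<^bsub>src X\<^esub> f \<otimes>\<^bsub>src X\<^esub> \<phi> \<sigma> \<otimes>\<^bsub>src X\<^esub> sact X \<sigma> f,
      inv\<^bsub>tgt X\<^esub> (bdry X f) \<otimes>\<^bsub>tgt X\<^esub> g))"

definition H0 :: "'s monoid \<Rightarrow> 's topology \<Rightarrow> ('s, 'f, 'g) xmod \<Rightarrow> (('s \<Rightarrow> 'f) \<times> 'g) set set" where
  "H0 \<Gamma> T X = orbits (src X) (Z0 \<Gamma> T X) (Z0_act \<Gamma> X)"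

definition C0 :: "'s monoid \<Rightarrow> 's topology \<Rightarrow> ('s, 'f, 'g) xmod \<Rightarrow> (('s \<Rightarrow> 'f) \<times> 'g) monoid" where
  "C0 \<Gamma> T X = \<lparr>carrier = cmaps T (src X) \<times> carrier (tgt X),
     mult = (\<lambda>(\<phi>\<^sub>1, g\<^sub>1) (\<phi>\<^sub>2, g\<^sub>2).
       (\<lambda>\<sigma>\<in>carrier \<Gamma>. xact X g\<^sub>1 (\<phi>\<^sub>2 \<sigma>) \<otimes>\<^bsub>src X\<^esub> \<phi>\<^sub>1 \<sigma>, g\<^sub>1 \<otimes>\<^bsub>tgt X\<^esub> g\<^sub>2)),
     one = (\<lambda>\<sigma>\<in>carrier \<Gamma>. \<one>\<^bsub>src X\<^esub>, \<one>\<^bsub>tgt X\<^esub>)\<rparr>"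

definition Z1 :: "'s monoid \<Rightarrow> 's topology \<Rightarrow> ('s, 'f, 'g) xmod \<Rightarrow>
    (('s \<times> 's \<Rightarrow> 'f) \<times> ('s \<Rightarrow> 'g)) set" where
  "Z1 \<Gamma> T X = {(h, \<psi>). h \<in> cmaps (prod_topology T T) (src X) \<and> \<psi> \<in> cmaps T (tgt X) \<and>
     (\<forall>\<sigma>\<in>carrier \<Gamma>. \<forall>\<tau>\<in>carrier \<Gamma>.
        \<psi> \<sigma> \<otimes>\<^bsub>tgt X\<^esub> tact X \<sigma> (\<psi> \<tau>) = inv\<^bsub>tgt X\<^esub> (bdry X (h (\<sigma>, \<tau>))) \<otimes>\<^bsub>tgt X\<^esub> \<psi> (\<sigma> \<otimes>\<^bsub>\<Gamma>\<^esub> \<tau>)) \<and>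
     (\<forall>\<sigma>\<in>carrier \<Gamma>. \<forall>\<tau>\<in>carrier \<Gamma>. \<forall>\<upsilon>\<in>carrier \<Gamma>.
        h (\<sigma>, \<tau> \<otimes>\<^bsub>\<Gamma>\<^esub> \<upsilon>) \<otimes>\<^bsub>src X\<^esub> xact X (\<psi> \<sigma>) (sact X \<sigma> (h (\<tau>, \<upsilon>))) =
        h (\<sigma> \<otimes>\<^bsub>\<Gamma>\<^esub> \<tau>, \<upsilon>) \<otimes>\<^bsub>src X\<^esub> h (\<sigma>, \<tau>))}"

definition Z1_act :: "'s monoid \<Rightarrow> ('s, 'f, 'g) xmod \<Rightarrow> ('s \<Rightarrow> 'f) \<times> 'g \<Rightarrow>
    ('s \<times> 's \<Rightarrow> 'f) \<times> ('s \<Rightarrow> 'g) \<Rightarrow> ('s \<times> 's \<Rightarrow> 'f) \<times> ('s \<Rightarrow> 'g)" where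
  "Z1_act \<Gamma> X = (\<lambda>(a, g) (h, \<psi>).
     (\<lambda>(\<sigma>, \<tau>)\<in>carrier \<Gamma> \<times> carrier \<Gamma>. xact X (inv\<^bsub>tgt X\<^esub> g)
        (a (\<sigma> \<otimes>\<^bsub>\<Gamma>\<^esub> \<tau>) \<otimes>\<^bsub>src X\<^esub> h (\<sigma>, \<tau>)
           \<otimes>\<^bsub>src X\<^esub> xact X (\<psi> \<sigma>) (sact X \<sigma> (inv\<^bsub>src X\<^esub> (a \<tau>)))
           \<otimes>\<^bsub>src X\<^esub> inv\<^bsub>src X\<^esub> (a \<sigma>)),
      \<lambda>\<sigma>\<in>carrier \<Gamma>. inv\<^bsub>tgt X\<^esub> g \<otimes>\<^bsub>tgt X\<^esub> bdry X (a \<sigma>) \<otimes>\<^bsub>tgt X\<^esub> \<psi> \<sigma> \<otimes>\<^bsub>tgt X\<^esub> tact X \<sigma> g))"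

definition H1 :: "'s monoid \<Rightarrow> 's topology \<Rightarrow> ('s, 'f, 'g) xmod \<Rightarrow>
    (('s \<times> 's \<Rightarrow> 'f) \<times> ('s \<Rightarrow> 'g)) set set" where
  "H1 \<Gamma> T X = orbits (C0 \<Gamma> T X) (Z1 \<Gamma> T X) (Z1_act \<Gamma> X)"

section \<open>Induced maps\<close>

text \<open>A class is sent to the union of the classes of the images of its cocycles. Orbits being
  pairwise disjoint, this union is itself a class exactly when all these images are cohomologous,
  so that bijectivity onto the set of classes includes well-definedness.\<close>

definition H0_map :: "'s monoid \<Rightarrow> ('s, 'f2, 'g2) xmod \<Rightarrow> ('f1 \<Rightarrow> 'f2) \<Rightarrow> ('g1 \<Rightarrow> 'g2) \<Rightarrow>
    (('s \<Rightarrow> 'f1) \<times> 'g1) set \<Rightarrow> (('s \<Rightarrow> 'f2) \<times> 'g2) set" where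
  "H0_map \<Gamma> Y e e' c =
     (\<Union>(\<phi>, g)\<in>c. orbit (src Y) (Z0_act \<Gamma> Y) (compose (carrier \<Gamma>) e \<phi>, e' g))"

definition H1_map :: "'s monoid \<Rightarrow> 's topology \<Rightarrow> ('s, 'f2, 'g2) xmod \<Rightarrow>
    ('f1 \<Rightarrow> 'f2) \<Rightarrow> ('g1 \<Rightarrow> 'g2) \<Rightarrow>
    (('s \<times> 's \<Rightarrow> 'f1) \<times> ('s \<Rightarrow> 'g1)) set \<Rightarrow> (('s \<times> 's \<Rightarrow> 'f2) \<times> ('s \<Rightarrow> 'g2)) set" where
  "H1_map \<Gamma> T Y e e' c =
     (\<Union>(h, \<psi>)\<in>c. orbit (C0 \<Gamma> T Y) (Z1_act \<Gamma> Y)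
        (compose (carrier \<Gamma> \<times> carrier \<Gamma>) e h, compose (carrier \<Gamma>) e' \<psi>))"

end

theory Submission
  imports Defs
begin

text \<open>A morphism is a quasi-isomorphism only if \<open>F\<^sub>1\<close> is the fibre product of \<open>G\<^sub>1\<close> and \<open>F\<^sub>2\<close> over \<open>G\<^sub>2\<close>
  and every element of \<open>G\<^sub>2\<close> is the product of an element of \<open>\<alpha>\<^sub>2(F\<^sub>2)\<close> and one of \<open>\<epsilon>\<^sub>0(G\<^sub>1)\<close>. By the
  second property every cocycle of the second crossed module is cohomologous to one whose
  \<open>G\<^sub>2\<close>-component lifts to \<open>G\<^sub>1\<close>. In a cocycle, the image under \<open>\<alpha>\<close> of the \<open>F\<close>-component is determined
  by the \<open>G\<close>-component, so that the fibre product property lifts the \<open>F\<^sub>2\<close>-component too, and uniqueness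
  of the lift gives the cocycle identities. Cochains relating two images of cocycles are lifted in
  the same way. All lifts are made pointwise from locally constant data, so they are locally
  constant.\<close>

section \<open>Orbits of right actions\<close>

text \<open>Once products are bracketed to the right, a letter and its inverse meet only in this
  form; with these rules the simplifier reduces group words.\<close>

lemma (in group) inv_mult_cancel:
  assumes "x \<in> carrier G" "y \<in> carrier G"
  shows "inv x \<otimes> (x \<otimes> y) = y" "x \<otimes> (inv x \<otimes> y) = y"
  using assms by (simp_all add: m_assoc [symmetric])

lemmas (in group) word_simps = m_assoc inv_mult_group inv_mult_cancel

text \<open>In \<open>act (g \<otimes> g')\<close> the element \<open>g\<close> acts first, so the
  action is on the right. \<open>orbit\<close> and \<open>orbits\<close> only use the set of
  translates and apply to it unchanged.\<close>

locale right_action = group G for G (structure) +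
  fixes Z :: "'z set" and act :: "'a \<Rightarrow> 'z \<Rightarrow> 'z"
  assumes act_closed: "\<lbrakk>g \<in> carrier G; z \<in> Z\<rbrakk> \<Longrightarrow> act g z \<in> Z"
    and act_one: "z \<in> Z \<Longrightarrow> act \<one> z = z"
    and act_mult: "\<lbrakk>g \<in> carrier G; g' \<in> carrier G; z \<in> Z\<rbrakk> \<Longrightarrow> act (g \<otimes> g') z = act g' (act g z)"
begin

lemma orbit_refl: "z \<in> Z \<Longrightarrow> z \<in> orbit G act z"
  unfolding orbit_def using act_one by force

lemma act_inv: "\<lbrakk>g \<in> carrier G; z \<in> Z\<rbrakk> \<Longrightarrow> act (inv g) (act g z) = z"
  using act_mult [of g "inv g" z] act_one by simp

lemma orbit_act:
  assumes "g \<in> carrier G" "z \<in> Z"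
  shows "orbit G act (act g z) = orbit G act z"
proof -
  have "orbit G act (act g z) \<subseteq> orbit G act z" if "g \<in> carrier G" "z \<in> Z" for g z
    using that by (auto simp: orbit_def act_mult [symmetric])
  from this [OF assms] this [of "inv g" "act g z"] show ?thesis
    using assms by (simp add: act_inv act_closed)
qed

lemma orbit_eq_iff:
  assumes "z \<in> Z" "z' \<in> Z"
  shows "orbit G act z = orbit G act z' \<longleftrightarrow> (\<exists>g\<in>carrier G. z' = act g z)"
proof
  assume "orbit G act z = orbit G act z'"
  with orbit_refl [OF assms(2)] show "\<exists>g\<in>carrier G. z' = act g z"
    by (auto simp: orbit_def)
qed (use assms orbit_act in auto)

end

text \<open>Bijectivity on classes is reduced to statements about representatives. Equivariance
  along \<open>m\<close> makes the union over a class a single orbit; \<open>inj\<close> and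
  \<open>surj\<close> are injectivity and surjectivity up to the actions. It serves with
  \<open>m\<close> equal to \<open>e\<close> in degree 0 and to \<open>Z0_map\<close> in degree
  1.\<close>

lemma bij_betw_orbits:
  assumes "right_action G Z act" and "right_action G' Z' act'"
    and m: "\<And>g. g \<in> carrier G \<Longrightarrow> m g \<in> carrier G'"
    and u: "\<And>z. z \<in> Z \<Longrightarrow> u z \<in> Z'"
    and equivariant: "\<And>g z. \<lbrakk>g \<in> carrier G; z \<in> Z\<rbrakk> \<Longrightarrow> u (act g z) = act' (m g) (u z)"
    and inj: "\<And>z z' g'. \<lbrakk>z \<in> Z; z' \<in> Z; g' \<in> carrier G'; u z' = act' g' (u z)\<rbrakk> \<Longrightarrow>
      \<exists>g\<in>carrier G. z' = act g z"
    and surj: "\<And>w. w \<in> Z' \<Longrightarrow> \<exists>g'\<in>carrier G'. \<exists>z\<in>Z. u z = act' g' w"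
  shows "bij_betw (\<lambda>c. \<Union>z\<in>c. orbit G' act' (u z)) (orbits G Z act) (orbits G' Z' act')"
proof -
  interpret A: right_action G Z act by fact
  interpret B: right_action G' Z' act' by fact
  let ?U = "\<lambda>c. \<Union>z\<in>c. orbit G' act' (u z)"
  \<comment> \<open>All orbits in this union coincide, and the index set is nonempty because it
    contains \<open>z\<close>.\<close>
  have U: "?U (orbit G act z) = orbit G' act' (u z)" if "z \<in> Z" for z
  proof -
    have eq: "orbit G' act' (u y) = orbit G' act' (u z)" if y: "y \<in> orbit G act z" for y
    proof -
      obtain g where "g \<in> carrier G" "y = act g z"
        using y by (auto simp: orbit_def)
      then show ?thesis
        using \<open>z \<in> Z\<close> by (simp add: equivariant m u B.orbit_act)
    qed
    have "?U (orbit G act z) = (\<Union>y\<in>orbit G act z. orbit G' act' (u z))"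
      by (rule SUP_cong [OF refl eq])
    then show ?thesis
      using A.orbit_refl [OF that] by (metis UN_constant empty_iff)
  qed
  have inj_U: "orbit G act z = orbit G act z'"
    if "z \<in> Z" "z' \<in> Z" "orbit G' act' (u z) = orbit G' act' (u z')" for z z'
    using that inj [of z z'] B.orbit_eq_iff [of "u z" "u z'"] A.orbit_eq_iff [of z z'] u by blast
  have surj_U: "\<exists>z\<in>Z. orbit G' act' w = orbit G' act' (u z)" if "w \<in> Z'" for w
    using surj [OF that] that by (metis B.orbit_act)
  show ?thesis
    unfolding bij_betw_def
  proof
    show "inj_on ?U (orbits G Z act)"
    proof (rule inj_onI)
      fix c c' assume "c \<in> orbits G Z act" "c' \<in> orbits G Z act" and eq: "?U c = ?U c'"
      then obtain z z' where z: "z \<in> Z" "z' \<in> Z" "c = orbit G act z" "c' = orbit G act z'"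
        unfolding orbits_def by blast
      show "c = c'"
        using inj_U [OF z(1,2)] eq unfolding z(3,4) U [OF z(1)] U [OF z(2)] by blast
    qed
    show "?U ` orbits G Z act = orbits G' Z' act'"
    proof
      show "?U ` orbits G Z act \<subseteq> orbits G' Z' act'"
        using u by (clarsimp simp add: orbits_def U simp del: UN_simps) blast
      show "orbits G' Z' act' \<subseteq> ?U ` orbits G Z act"
      proof
        fix c assume "c \<in> orbits G' Z' act'"
        then obtain z where z: "z \<in> Z" "c = orbit G' act' (u z)"
          unfolding orbits_def using surj_U by blast
        then have "c = ?U (orbit G act z)"
          using U by simp
        then show "c \<in> ?U ` orbits G Z act"
          unfolding orbits_def using z(1) by blast
      qed
    qed
  qed
qed

section \<open>Locally constant maps\<close>

text \<open>Continuity into a discrete space is local constancy. Stated with the filter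
  \<open>nhdsin\<close>, it passes to any expression built from finitely many locally constant
  ingredients by \<open>eventually_elim\<close>.\<close>

lemma cmapsI:
  assumes "f \<in> extensional (topspace X)"
    and "\<And>x. x \<in> topspace X \<Longrightarrow> f x \<in> carrier A"
    and "\<And>x. x \<in> topspace X \<Longrightarrow> \<forall>\<^sub>F y in nhdsin X x. f y = f x"
  shows "f \<in> cmaps X A"
proof -
  have "openin X {x \<in> topspace X. f x \<in> U}" for U
    unfolding openin_subopen [of X "{x \<in> topspace X. f x \<in> U}"]
  proof
    fix x assume x: "x \<in> {x \<in> topspace X. f x \<in> U}"
    with assms(3) [of x] obtain S where "openin X S" "x \<in> S" "\<forall>y\<in>S. f y = f x"
      by (auto simp: eventually_nhdsin)
    with x show "\<exists>T. openin X T \<and> x \<in> T \<and> T \<subseteq> {x \<in> topspace X. f x \<in> U}"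
      using openin_subset by (intro exI [of _ S]) fastforce
  qed
  then show ?thesis
    using assms(1,2) by (auto simp: cmaps_def continuous_map_def)
qed

lemma cmaps_extensional: "f \<in> cmaps X A \<Longrightarrow> f \<in> extensional (topspace X)"
  by (simp add: cmaps_def)

lemma cmaps_closed: "\<lbrakk>f \<in> cmaps X A; x \<in> topspace X\<rbrakk> \<Longrightarrow> f x \<in> carrier A"
  by (auto simp: cmaps_def continuous_map_def)

text \<open>The preimage of the open singleton of \<open>f (s x)\<close> is the required
  neighbourhood. The map \<open>s\<close> will be a projection or the multiplication, for cochains
  evaluated at \<sigma>, \<tau> or \<sigma>\<tau> as functions of a pair.\<close>

lemma cmaps_eventually_comp:
  assumes "f \<in> cmaps Y A" "continuous_map X Y s" "x \<in> topspace X"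
  shows "\<forall>\<^sub>F y in nhdsin X x. f (s y) = f (s x)"
proof -
  have "continuous_map X (discrete_topology (carrier A)) (\<lambda>x. f (s x))"
    using continuous_map_compose [OF assms(2), of _ f] assms(1) by (simp add: cmaps_def o_def)
  moreover have "f (s x) \<in> carrier A"
    using continuous_map_funspace [OF calculation] assms(3) by auto
  ultimately have "openin X {y \<in> topspace X. f (s y) \<in> {f (s x)}}"
    by (intro openin_continuous_map_preimage [of X "discrete_topology (carrier A)"]) simp_all
  then show ?thesis
    using assms(3) by (auto simp: eventually_nhdsin)
qed

lemma cmaps_eventually:
  "\<lbrakk>f \<in> cmaps X A; x \<in> topspace X\<rbrakk> \<Longrightarrow> \<forall>\<^sub>F y in nhdsin X x. f y = f x"
  using cmaps_eventually_comp [of f X A X "\<lambda>x. x"] by simp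

text \<open>Every map \<open>k\<close> between discrete groups preserves local constancy, so this
  covers choice functions as well as homomorphisms.\<close>

lemma cmaps_compose:
  assumes "f \<in> cmaps X A" "\<And>a. a \<in> carrier A \<Longrightarrow> k a \<in> carrier B"
  shows "compose (topspace X) k f \<in> cmaps X B"
proof (rule cmapsI)
  fix x assume x: "x \<in> topspace X"
  then show "compose (topspace X) k f x \<in> carrier B"
    using assms cmaps_closed by (fastforce simp: compose_def)
  have "\<forall>\<^sub>F y in nhdsin X x. y \<in> topspace X"
    unfolding eventually_nhdsin by auto
  with cmaps_eventually [OF assms(1) x]
  show "\<forall>\<^sub>F y in nhdsin X x. compose (topspace X) k f y = compose (topspace X) k f x"
    by eventually_elim (use x in \<open>simp add: compose_def\<close>)
qed (simp add: compose_def)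

section \<open>Actions by automorphisms\<close>

context aut_action
begin

lemma act_auto: "h \<in> carrier H \<Longrightarrow> \<rho> h \<in> auto A"
  using action_hom by (auto simp: hom_def AutoGroup_def)

lemma act_closed [simp]: "\<lbrakk>h \<in> carrier H; a \<in> carrier A\<rbrakk> \<Longrightarrow> \<rho> h a \<in> carrier A"
  using act_auto by (auto simp: auto_def hom_def)

lemma act_mult: "\<lbrakk>h \<in> carrier H; a \<in> carrier A; b \<in> carrier A\<rbrakk> \<Longrightarrow>
    \<rho> h (a \<otimes>\<^bsub>A\<^esub> b) = \<rho> h a \<otimes>\<^bsub>A\<^esub> \<rho> h b"
  using act_auto by (auto simp: auto_def hom_def)

lemma act_group_hom: "h \<in> carrier H \<Longrightarrow> group_hom A A (\<rho> h)"
  using act_auto by unfold_locales (auto simp: auto_def)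

lemma act_one [simp]: "h \<in> carrier H \<Longrightarrow> \<rho> h \<one>\<^bsub>A\<^esub> = \<one>\<^bsub>A\<^esub>"
  using act_group_hom by (simp add: group_hom.hom_one)

lemma act_inv: "\<lbrakk>h \<in> carrier H; a \<in> carrier A\<rbrakk> \<Longrightarrow> \<rho> h (inv\<^bsub>A\<^esub> a) = inv\<^bsub>A\<^esub> (\<rho> h a)"
  using act_group_hom by (simp add: group_hom.hom_inv)

lemma act_comp:
  assumes "h \<in> carrier H" "k \<in> carrier H" "a \<in> carrier A"
  shows "\<rho> (h \<otimes>\<^bsub>H\<^esub> k) a = \<rho> h (\<rho> k a)"
proof -
  have "\<rho> (h \<otimes>\<^bsub>H\<^esub> k) = compose (carrier A) (\<rho> h) (\<rho> k)"
    using hom_mult [OF action_hom assms(1,2)] act_auto assms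
    by (simp add: AutoGroup_def BijGroup_def auto_def)
  then show ?thesis
    using assms by (simp add: compose_def)
qed

text \<open>The unit acts by an idempotent map, and an injective idempotent map is the
  identity.\<close>

lemma act_id [simp]:
  assumes "a \<in> carrier A"
  shows "\<rho> \<one>\<^bsub>H\<^esub> a = a"
proof -
  have "\<rho> \<one>\<^bsub>H\<^esub> (\<rho> \<one>\<^bsub>H\<^esub> a) = \<rho> \<one>\<^bsub>H\<^esub> a"
    using act_comp [of "\<one>\<^bsub>H\<^esub>" "\<one>\<^bsub>H\<^esub>" a] assms by simp
  moreover have "inj_on (\<rho> \<one>\<^bsub>H\<^esub>) (carrier A)"
    using act_auto [of "\<one>\<^bsub>H\<^esub>"] by (auto simp: auto_def Bij_def bij_betw_def)
  ultimately show ?thesis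
    using assms by (simp add: inj_on_eq_iff)
qed

lemma act_inv_act [simp]:
  assumes "h \<in> carrier H" "a \<in> carrier A"
  shows "\<rho> (inv\<^bsub>H\<^esub> h) (\<rho> h a) = a" "\<rho> h (\<rho> (inv\<^bsub>H\<^esub> h) a) = a"
  using act_comp [of "inv\<^bsub>H\<^esub> h" h a] act_comp [of h "inv\<^bsub>H\<^esub> h" a] assms by simp_all

end

context discrete_Gamma_group
begin

text \<open>The set is the left coset of the stabilizer of \<open>a\<close> through \<sigma>, the
  preimage of an open set under a translation.\<close>

lemma act_locally_constant:
  assumes "a \<in> carrier A" "\<sigma> \<in> carrier \<Gamma>"
  shows "openin T {\<tau> \<in> carrier \<Gamma>. \<rho> \<tau> a = \<rho> \<sigma> a}"
proof -
  have "continuous_map T T (\<lambda>\<tau>. inv\<^bsub>\<Gamma>\<^esub> \<sigma> \<otimes>\<^bsub>\<Gamma>\<^esub> \<tau>)"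
    using continuous_map_compose [OF _ continuous_mult, of T "\<lambda>\<tau>. (inv\<^bsub>\<Gamma>\<^esub> \<sigma>, \<tau>)"] assms(2)
    by (simp add: o_def continuous_map_pairedI topspace_eq)
  from openin_continuous_map_preimage [OF this open_stabilizer [OF assms(1)]]
  have "openin T {\<tau> \<in> topspace T. inv\<^bsub>\<Gamma>\<^esub> \<sigma> \<otimes>\<^bsub>\<Gamma>\<^esub> \<tau> \<in> stabilizer \<Gamma> \<rho> a}" .
  also have "{\<tau> \<in> topspace T. inv\<^bsub>\<Gamma>\<^esub> \<sigma> \<otimes>\<^bsub>\<Gamma>\<^esub> \<tau> \<in> stabilizer \<Gamma> \<rho> a} = {\<tau> \<in> carrier \<Gamma>. \<rho> \<tau> a = \<rho> \<sigma> a}"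
  proof -
    have "\<rho> (inv\<^bsub>\<Gamma>\<^esub> \<sigma>) (\<rho> \<tau> a) = a \<longleftrightarrow> \<rho> \<tau> a = \<rho> \<sigma> a" if "\<tau> \<in> carrier \<Gamma>" for \<tau>
      using assms that by (metis act_closed act_inv_act)
    then show ?thesis
      using assms by (auto simp: stabilizer_def topspace_eq act_comp)
  qed
  finally show ?thesis .
qed

text \<open>Near \<open>x\<close> the argument is the constant \<open>u x\<close>, so only the
  acting element varies, and the orbit map of \<open>u x\<close> is locally constant.\<close>

lemma eventually_act:
  assumes "continuous_map X T s" "x \<in> topspace X" "u x \<in> carrier A"
    and "\<forall>\<^sub>F y in nhdsin X x. u y = u x"
  shows "\<forall>\<^sub>F y in nhdsin X x. \<rho> (s y) (u y) = \<rho> (s x) (u x)"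
proof -
  have s: "s y \<in> carrier \<Gamma>" if "y \<in> topspace X" for y
    using assms(1) that by (auto simp: continuous_map_def topspace_eq)
  have "openin X {y \<in> topspace X. s y \<in> {\<tau> \<in> carrier \<Gamma>. \<rho> \<tau> (u x) = \<rho> (s x) (u x)}}"
    using assms s by (intro openin_continuous_map_preimage [OF assms(1)] act_locally_constant) auto
  then have "\<forall>\<^sub>F y in nhdsin X x. \<rho> (s y) (u x) = \<rho> (s x) (u x)"
    using assms(2) s by (auto simp: eventually_nhdsin)
  with assms(4) show ?thesis
    by eventually_elim simp
qed

end

section \<open>The actions on cocycles\<close>

context topological_group
begin

lemma eventually_pair:
  assumes "a \<in> cmaps T A" "p \<in> carrier \<Gamma> \<times> carrier \<Gamma>"
  shows "\<forall>\<^sub>F q in nhdsin (prod_topology T T) p. a (fst q) = a (fst p)"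
    and "\<forall>\<^sub>F q in nhdsin (prod_topology T T) p. a (snd q) = a (snd p)"
    and "\<forall>\<^sub>F q in nhdsin (prod_topology T T) p. a (fst q \<otimes>\<^bsub>\<Gamma>\<^esub> snd q) = a (fst p \<otimes>\<^bsub>\<Gamma>\<^esub> snd p)"
  using assms continuous_mult
  by (auto intro!: cmaps_eventually_comp [OF assms(1)]
    simp: topspace_eq continuous_map_fst continuous_map_snd case_prod_unfold)

lemma eventually_in_carrier: "\<forall>\<^sub>F \<sigma> in nhdsin T \<tau>. \<sigma> \<in> carrier \<Gamma>"
  unfolding eventually_nhdsin using topspace_eq by (auto intro!: exI [of _ "carrier \<Gamma>"] simp flip: topspace_eq)

lemma eventually_in_carrier_pair:
  "\<forall>\<^sub>F q in nhdsin (prod_topology T T) p. q \<in> carrier \<Gamma> \<times> carrier \<Gamma>"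
  unfolding eventually_nhdsin topspace_prod_topology topspace_eq
  using openin_topspace [of "prod_topology T T"]
  by (auto simp: topspace_eq intro!: exI [of _ "carrier \<Gamma> \<times> carrier \<Gamma>"])

end

context crossed_module
begin

sublocale bdry: group_hom "src X" "tgt X" "bdry X"
  by unfold_locales (rule bdry_hom)

lemma xact_bdry:
  "\<lbrakk>f \<in> carrier (src X); f' \<in> carrier (src X)\<rbrakk> \<Longrightarrow>
    xact X (bdry X f) f' = f \<otimes>\<^bsub>src X\<^esub> f' \<otimes>\<^bsub>src X\<^esub> inv\<^bsub>src X\<^esub> f"
  by (simp add: peiffer)

lemma xact_inv_bdry:
  "\<lbrakk>f \<in> carrier (src X); f' \<in> carrier (src X)\<rbrakk> \<Longrightarrow>
    xact X (inv\<^bsub>tgt X\<^esub> (bdry X f)) f' = inv\<^bsub>src X\<^esub> f \<otimes>\<^bsub>src X\<^esub> f' \<otimes>\<^bsub>src X\<^esub> f"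
  using xact_bdry [of "inv\<^bsub>src X\<^esub> f" f'] by simp

lemmas xmod_simps = A.word_simps H.word_simps act_mult act_inv act_comp
  xact_bdry xact_inv_bdry bdry_xact

end

context Gamma_crossed_module
begin

text \<open>These rules bring words to a normal form: actions move onto single letters with \<Gamma>
  innermost, actions of products are split, boundaries act by conjugation, and the boundary map is
  moved through both actions. The identities between cocycles below become equalities of such
  words.\<close>

lemmas Gamma_simps = xmod_simps src.act_mult src.act_inv src.act_comp tgt.act_mult tgt.act_inv
  tgt.act_comp bdry_equivariant xact_equivariant

section \<open>Cocycles in degree 0\<close>

lemma Z0_closed:
  assumes "(\<phi>, g) \<in> Z0 \<Gamma> T X"
  shows "g \<in> carrier (tgt X)" "\<sigma> \<in> carrier \<Gamma> \<Longrightarrow> \<phi> \<sigma> \<in> carrier (src X)"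
  using assms cmaps_closed [of \<phi> T "src X" \<sigma>] by (auto simp: Z0_def src.topspace_eq)

lemma Z0_extensional: "(\<phi>, g) \<in> Z0 \<Gamma> T X \<Longrightarrow> \<phi> \<in> extensional (carrier \<Gamma>)"
  using cmaps_extensional [of \<phi> T "src X"] by (simp add: Z0_def src.topspace_eq)

text \<open>This is the second cocycle condition solved for the boundary, which thus depends on
  \<open>g\<close> alone; lifting through the fibre product relies on it.\<close>

lemma Z0_bdry:
  assumes "(\<phi>, g) \<in> Z0 \<Gamma> T X" "\<sigma> \<in> carrier \<Gamma>"
  shows "bdry X (\<phi> \<sigma>) = g \<otimes>\<^bsub>tgt X\<^esub> inv\<^bsub>tgt X\<^esub> (tact X \<sigma> g)"
proof -
  have "tact X \<sigma> g = bdry X (inv\<^bsub>src X\<^esub> (\<phi> \<sigma>)) \<otimes>\<^bsub>tgt X\<^esub> g"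
    using assms by (auto simp: Z0_def)
  then show ?thesis
    using assms(2) Z0_closed [OF assms(1)] by (simp add: Gamma_simps)
qed

lemma cmaps_Z0_act:
  assumes "\<phi> \<in> cmaps T (src X)" "f \<in> carrier (src X)"
  shows "(\<lambda>\<sigma>\<in>carrier \<Gamma>. inv\<^bsub>src X\<^esub> f \<otimes>\<^bsub>src X\<^esub> \<phi> \<sigma> \<otimes>\<^bsub>src X\<^esub> sact X \<sigma> f) \<in> cmaps T (src X)"
proof (rule cmapsI)
  fix \<sigma> assume \<sigma>: "\<sigma> \<in> topspace T"
  then show "(\<lambda>\<sigma>\<in>carrier \<Gamma>. inv\<^bsub>src X\<^esub> f \<otimes>\<^bsub>src X\<^esub> \<phi> \<sigma> \<otimes>\<^bsub>src X\<^esub> sact X \<sigma> f) \<sigma> \<in> carrier (src X)"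
    using assms cmaps_closed [OF assms(1)] by (simp add: src.topspace_eq)
  have "\<forall>\<^sub>F \<tau> in nhdsin T \<sigma>. sact X \<tau> f = sact X \<sigma> f"
    using src.eventually_act [of T "\<lambda>\<sigma>. \<sigma>" \<sigma> "\<lambda>\<sigma>. f"] assms \<sigma> by simp
  with cmaps_eventually [OF assms(1) \<sigma>] src.eventually_in_carrier [of \<sigma>]
  show "\<forall>\<^sub>F \<tau> in nhdsin T \<sigma>. (\<lambda>\<sigma>\<in>carrier \<Gamma>. inv\<^bsub>src X\<^esub> f \<otimes>\<^bsub>src X\<^esub> \<phi> \<sigma> \<otimes>\<^bsub>src X\<^esub> sact X \<sigma> f) \<tau> =
      (\<lambda>\<sigma>\<in>carrier \<Gamma>. inv\<^bsub>src X\<^esub> f \<otimes>\<^bsub>src X\<^esub> \<phi> \<sigma> \<otimes>\<^bsub>src X\<^esub> sact X \<sigma> f) \<sigma>"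
    by eventually_elim (use \<sigma> in \<open>simp add: src.topspace_eq\<close>)
qed (simp add: src.topspace_eq)

lemma Z0_right_action: "right_action (src X) (Z0 \<Gamma> T X) (Z0_act \<Gamma> X)"
proof unfold_locales
  fix f z assume f: "f \<in> carrier (src X)" and z: "z \<in> Z0 \<Gamma> T X"
  obtain \<phi> g where [simp]: "z = (\<phi>, g)" by (cases z)
  note [simp] = Z0_closed [OF z [simplified]]
  have mult: "\<phi> (\<sigma> \<otimes>\<^bsub>\<Gamma>\<^esub> \<tau>) = \<phi> \<sigma> \<otimes>\<^bsub>src X\<^esub> sact X \<sigma> (\<phi> \<tau>)" if "\<sigma> \<in> carrier \<Gamma>" "\<tau> \<in> carrier \<Gamma>" for \<sigma> \<tau>
    using z that by (simp add: Z0_def)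
  have g: "tact X \<sigma> g = inv\<^bsub>tgt X\<^esub> (bdry X (\<phi> \<sigma>)) \<otimes>\<^bsub>tgt X\<^esub> g" if "\<sigma> \<in> carrier \<Gamma>" for \<sigma>
    using z that by (simp add: Z0_def)
  have "\<phi> \<in> cmaps T (src X)"
    using z by (simp add: Z0_def)
  with f show "Z0_act \<Gamma> X f z \<in> Z0 \<Gamma> T X"
    by (simp add: Z0_act_def Z0_def cmaps_Z0_act mult g Gamma_simps)
next
  fix z assume z: "z \<in> Z0 \<Gamma> T X"
  obtain \<phi> g where [simp]: "z = (\<phi>, g)" by (cases z)
  note [simp] = Z0_closed [OF z [simplified]]
  have "\<phi> \<in> extensional (carrier \<Gamma>)"
    using z Z0_extensional by simp
  then show "Z0_act \<Gamma> X \<one>\<^bsub>src X\<^esub> z = z"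
    by (auto simp: Z0_act_def extensional_def)
next
  fix f f' z assume f: "f \<in> carrier (src X)" "f' \<in> carrier (src X)" and z: "z \<in> Z0 \<Gamma> T X"
  obtain \<phi> g where [simp]: "z = (\<phi>, g)" by (cases z)
  note [simp] = Z0_closed [OF z [simplified]]
  show "Z0_act \<Gamma> X (f \<otimes>\<^bsub>src X\<^esub> f') z = Z0_act \<Gamma> X f' (Z0_act \<Gamma> X f z)"
    using f by (auto simp: Z0_act_def Gamma_simps)
qed

section \<open>The group acting on cocycles in degree 1\<close>

lemma cmaps_C0_mult:
  assumes "\<phi> \<in> cmaps T (src X)" "\<phi>' \<in> cmaps T (src X)" "g \<in> carrier (tgt X)"
  shows "(\<lambda>\<sigma>\<in>carrier \<Gamma>. xact X g (\<phi>' \<sigma>) \<otimes>\<^bsub>src X\<^esub> \<phi> \<sigma>) \<in> cmaps T (src X)"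
proof (rule cmapsI)
  fix \<sigma> assume \<sigma>: "\<sigma> \<in> topspace T"
  then show "(\<lambda>\<sigma>\<in>carrier \<Gamma>. xact X g (\<phi>' \<sigma>) \<otimes>\<^bsub>src X\<^esub> \<phi> \<sigma>) \<sigma> \<in> carrier (src X)"
    using assms cmaps_closed by (fastforce simp add: src.topspace_eq)
  from cmaps_eventually [OF assms(1) \<sigma>] cmaps_eventually [OF assms(2) \<sigma>] src.eventually_in_carrier [of \<sigma>]
  show "\<forall>\<^sub>F \<tau> in nhdsin T \<sigma>. (\<lambda>\<sigma>\<in>carrier \<Gamma>. xact X g (\<phi>' \<sigma>) \<otimes>\<^bsub>src X\<^esub> \<phi> \<sigma>) \<tau> =
      (\<lambda>\<sigma>\<in>carrier \<Gamma>. xact X g (\<phi>' \<sigma>) \<otimes>\<^bsub>src X\<^esub> \<phi> \<sigma>) \<sigma>"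
    by eventually_elim (use \<sigma> in \<open>simp add: src.topspace_eq\<close>)
qed (simp add: src.topspace_eq)

lemma cmaps_one: "(\<lambda>\<sigma>\<in>carrier \<Gamma>. \<one>\<^bsub>src X\<^esub>) \<in> cmaps T (src X)"
proof (rule cmapsI)
  fix \<sigma> assume \<sigma>: "\<sigma> \<in> topspace T"
  from src.eventually_in_carrier [of \<sigma>]
  show "\<forall>\<^sub>F \<tau> in nhdsin T \<sigma>. (\<lambda>\<sigma>\<in>carrier \<Gamma>. \<one>\<^bsub>src X\<^esub>) \<tau> = (\<lambda>\<sigma>\<in>carrier \<Gamma>. \<one>\<^bsub>src X\<^esub>) \<sigma>"
    by eventually_elim (use \<sigma> in \<open>simp add: src.topspace_eq\<close>)
qed (simp_all add: src.topspace_eq)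

lemma cmaps_C0_inv:
  assumes "\<phi> \<in> cmaps T (src X)" "g \<in> carrier (tgt X)"
  shows "(\<lambda>\<sigma>\<in>carrier \<Gamma>. xact X g (inv\<^bsub>src X\<^esub> (\<phi> \<sigma>))) \<in> cmaps T (src X)"
proof (rule cmapsI)
  fix \<sigma> assume \<sigma>: "\<sigma> \<in> topspace T"
  then show "(\<lambda>\<sigma>\<in>carrier \<Gamma>. xact X g (inv\<^bsub>src X\<^esub> (\<phi> \<sigma>))) \<sigma> \<in> carrier (src X)"
    using assms cmaps_closed by (fastforce simp add: src.topspace_eq)
  from cmaps_eventually [OF assms(1) \<sigma>] src.eventually_in_carrier [of \<sigma>]
  show "\<forall>\<^sub>F \<tau> in nhdsin T \<sigma>. (\<lambda>\<sigma>\<in>carrier \<Gamma>. xact X g (inv\<^bsub>src X\<^esub> (\<phi> \<sigma>))) \<tau> =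
      (\<lambda>\<sigma>\<in>carrier \<Gamma>. xact X g (inv\<^bsub>src X\<^esub> (\<phi> \<sigma>))) \<sigma>"
    by eventually_elim (use \<sigma> in \<open>simp add: src.topspace_eq\<close>)
qed (simp add: src.topspace_eq)

text \<open>This is the semidirect product of \<open>G\<close> with the opposite of the pointwise
  group of continuous maps to \<open>F\<close>.\<close>

lemma group_C0: "group (C0 \<Gamma> T X)"
proof (rule groupI)
  fix x y z
  assume xyz: "x \<in> carrier (C0 \<Gamma> T X)" "y \<in> carrier (C0 \<Gamma> T X)" "z \<in> carrier (C0 \<Gamma> T X)"
  obtain a b c g h k where [simp]: "x = (a, g)" "y = (b, h)" "z = (c, k)"
    by (cases x, cases y, cases z)
  have [simp]: "a \<sigma> \<in> carrier (src X)" "b \<sigma> \<in> carrier (src X)" "c \<sigma> \<in> carrier (src X)"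
    if "\<sigma> \<in> carrier \<Gamma>" for \<sigma>
    using that xyz cmaps_closed [of _ T "src X" \<sigma>] by (auto simp: C0_def src.topspace_eq)
  show "x \<otimes>\<^bsub>C0 \<Gamma> T X\<^esub> y \<otimes>\<^bsub>C0 \<Gamma> T X\<^esub> z = x \<otimes>\<^bsub>C0 \<Gamma> T X\<^esub> (y \<otimes>\<^bsub>C0 \<Gamma> T X\<^esub> z)"
    using xyz by (auto simp: C0_def Gamma_simps)
next
  fix x assume x: "x \<in> carrier (C0 \<Gamma> T X)"
  obtain a g where [simp]: "x = (a, g)" by (cases x)
  have [simp]: "a \<sigma> \<in> carrier (src X)" if "\<sigma> \<in> carrier \<Gamma>" for \<sigma>
    using that x cmaps_closed [of _ T "src X" \<sigma>] by (auto simp: C0_def src.topspace_eq)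
  have "a \<in> extensional (carrier \<Gamma>)"
    using x cmaps_extensional by (fastforce simp: C0_def src.topspace_eq)
  then show "\<one>\<^bsub>C0 \<Gamma> T X\<^esub> \<otimes>\<^bsub>C0 \<Gamma> T X\<^esub> x = x"
    using x by (auto simp: C0_def extensional_def)
  \<comment> \<open>By the group law, the first component \<open>b\<close> of a left inverse has to
    make \<open>xact X (inv g) (a \<sigma>) \<otimes> b \<sigma>\<close> trivial.\<close>
  let ?y = "(\<lambda>\<sigma>\<in>carrier \<Gamma>. xact X (inv\<^bsub>tgt X\<^esub> g) (inv\<^bsub>src X\<^esub> (a \<sigma>)), inv\<^bsub>tgt X\<^esub> g)"
  have "?y \<in> carrier (C0 \<Gamma> T X)"
    using x by (simp add: C0_def cmaps_C0_inv)
  moreover have "?y \<otimes>\<^bsub>C0 \<Gamma> T X\<^esub> x = \<one>\<^bsub>C0 \<Gamma> T X\<^esub>"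
    using x by (auto simp: C0_def act_inv)
  ultimately show "\<exists>y\<in>carrier (C0 \<Gamma> T X). y \<otimes>\<^bsub>C0 \<Gamma> T X\<^esub> x = \<one>\<^bsub>C0 \<Gamma> T X\<^esub>"
    by blast
qed (auto simp: C0_def cmaps_C0_mult cmaps_one)

section \<open>Cocycles in degree 1\<close>

lemma Z1_closed:
  assumes "(h, \<psi>) \<in> Z1 \<Gamma> T X" "\<sigma> \<in> carrier \<Gamma>"
  shows "\<psi> \<sigma> \<in> carrier (tgt X)" "\<tau> \<in> carrier \<Gamma> \<Longrightarrow> h (\<sigma>, \<tau>) \<in> carrier (src X)"
  using assms cmaps_closed [of \<psi> T "tgt X" \<sigma>]
    cmaps_closed [of h "prod_topology T T" "src X" "(\<sigma>, \<tau>)"]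
  by (auto simp: Z1_def src.topspace_eq)

lemma Z1_extensional:
  assumes "(h, \<psi>) \<in> Z1 \<Gamma> T X"
  shows "h \<in> extensional (carrier \<Gamma> \<times> carrier \<Gamma>)" "\<psi> \<in> extensional (carrier \<Gamma>)"
  using assms cmaps_extensional [of h "prod_topology T T" "src X"]
    cmaps_extensional [of \<psi> T "tgt X"]
  by (simp_all add: Z1_def src.topspace_eq)

text \<open>The first condition on a cocycle is needed in two solved forms: for \<psi> at a product,
  as a rewrite rule that eliminates this value, and for the boundary of \<open>h\<close>, which the
  lifting argument prescribes.\<close>

lemma Z1_cond_iff:
  assumes "f \<in> carrier (src X)" "g \<in> carrier (tgt X)" "k \<in> carrier (tgt X)" "l \<in> carrier (tgt X)"
  shows "g \<otimes>\<^bsub>tgt X\<^esub> k = inv\<^bsub>tgt X\<^esub> (bdry X f) \<otimes>\<^bsub>tgt X\<^esub> l \<longleftrightarrow>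
      l = bdry X f \<otimes>\<^bsub>tgt X\<^esub> (g \<otimes>\<^bsub>tgt X\<^esub> k)"
    and "g \<otimes>\<^bsub>tgt X\<^esub> k = inv\<^bsub>tgt X\<^esub> (bdry X f) \<otimes>\<^bsub>tgt X\<^esub> l \<longleftrightarrow>
      bdry X f = l \<otimes>\<^bsub>tgt X\<^esub> inv\<^bsub>tgt X\<^esub> k \<otimes>\<^bsub>tgt X\<^esub> inv\<^bsub>tgt X\<^esub> g"
proof -
  show 1: "g \<otimes>\<^bsub>tgt X\<^esub> k = inv\<^bsub>tgt X\<^esub> (bdry X f) \<otimes>\<^bsub>tgt X\<^esub> l \<longleftrightarrow>
      l = bdry X f \<otimes>\<^bsub>tgt X\<^esub> (g \<otimes>\<^bsub>tgt X\<^esub> k)"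
    using assms H.inv_solve_left by auto
  show "g \<otimes>\<^bsub>tgt X\<^esub> k = inv\<^bsub>tgt X\<^esub> (bdry X f) \<otimes>\<^bsub>tgt X\<^esub> l \<longleftrightarrow>
      bdry X f = l \<otimes>\<^bsub>tgt X\<^esub> inv\<^bsub>tgt X\<^esub> k \<otimes>\<^bsub>tgt X\<^esub> inv\<^bsub>tgt X\<^esub> g"
    unfolding 1 using assms by (auto simp: H.word_simps)
qed

lemma Z1_bdry:
  assumes z: "(h, \<psi>) \<in> Z1 \<Gamma> T X" and "\<sigma> \<in> carrier \<Gamma>" "\<tau> \<in> carrier \<Gamma>"
  shows "bdry X (h (\<sigma>, \<tau>)) = \<psi> (\<sigma> \<otimes>\<^bsub>\<Gamma>\<^esub> \<tau>) \<otimes>\<^bsub>tgt X\<^esub>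
    inv\<^bsub>tgt X\<^esub> (tact X \<sigma> (\<psi> \<tau>)) \<otimes>\<^bsub>tgt X\<^esub> inv\<^bsub>tgt X\<^esub> (\<psi> \<sigma>)"
  using assms Z1_closed [OF z] by (subst Z1_cond_iff(2) [symmetric]) (auto simp: Z1_def)

lemma cmaps_Z1_act:
  assumes h: "h \<in> cmaps (prod_topology T T) (src X)" and \<psi>: "\<psi> \<in> cmaps T (tgt X)"
    and a: "a \<in> cmaps T (src X)" and g: "g \<in> carrier (tgt X)"
    and act: "Z1_act \<Gamma> X (a, g) (h, \<psi>) = (h', \<psi>')"
  shows "h' \<in> cmaps (prod_topology T T) (src X)" "\<psi>' \<in> cmaps T (tgt X)"
proof -
  have h': "h' = (\<lambda>(\<sigma>, \<tau>)\<in>carrier \<Gamma> \<times> carrier \<Gamma>. xact X (inv\<^bsub>tgt X\<^esub> g)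
        (a (\<sigma> \<otimes>\<^bsub>\<Gamma>\<^esub> \<tau>) \<otimes>\<^bsub>src X\<^esub> h (\<sigma>, \<tau>)
           \<otimes>\<^bsub>src X\<^esub> xact X (\<psi> \<sigma>) (sact X \<sigma> (inv\<^bsub>src X\<^esub> (a \<tau>)))
           \<otimes>\<^bsub>src X\<^esub> inv\<^bsub>src X\<^esub> (a \<sigma>)))"
    and \<psi>': "\<psi>' = (\<lambda>\<sigma>\<in>carrier \<Gamma>.
      inv\<^bsub>tgt X\<^esub> g \<otimes>\<^bsub>tgt X\<^esub> bdry X (a \<sigma>) \<otimes>\<^bsub>tgt X\<^esub> \<psi> \<sigma> \<otimes>\<^bsub>tgt X\<^esub> tact X \<sigma> g)"
    using act by (simp_all add: Z1_act_def)
  have [simp]: "a \<sigma> \<in> carrier (src X)" "\<psi> \<sigma> \<in> carrier (tgt X)" if "\<sigma> \<in> carrier \<Gamma>" for \<sigma>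
    using that cmaps_closed [OF a] cmaps_closed [OF \<psi>] by (auto simp: src.topspace_eq)
  have [simp]: "h (\<sigma>, \<tau>) \<in> carrier (src X)" if "\<sigma> \<in> carrier \<Gamma>" "\<tau> \<in> carrier \<Gamma>" for \<sigma> \<tau>
    using that cmaps_closed [OF h] by (auto simp: src.topspace_eq)
  show "\<psi>' \<in> cmaps T (tgt X)"
  proof (rule cmapsI)
    fix \<sigma> assume \<sigma>: "\<sigma> \<in> topspace T"
    then show "\<psi>' \<sigma> \<in> carrier (tgt X)"
      using g by (simp add: \<psi>' src.topspace_eq)
    have "\<forall>\<^sub>F \<tau> in nhdsin T \<sigma>. tact X \<tau> g = tact X \<sigma> g"
      using tgt.eventually_act [of T "\<lambda>\<sigma>. \<sigma>" \<sigma> "\<lambda>\<sigma>. g"] g \<sigma> by simp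
    with cmaps_eventually [OF a \<sigma>] cmaps_eventually [OF \<psi> \<sigma>] src.eventually_in_carrier [of \<sigma>]
    show "\<forall>\<^sub>F \<tau> in nhdsin T \<sigma>. \<psi>' \<tau> = \<psi>' \<sigma>"
      by eventually_elim (use \<sigma> in \<open>simp add: \<psi>' src.topspace_eq\<close>)
  qed (simp add: \<psi>' src.topspace_eq)
  show "h' \<in> cmaps (prod_topology T T) (src X)"
  proof (rule cmapsI)
    fix p assume p: "p \<in> topspace (prod_topology T T)"
    then have p': "p \<in> carrier \<Gamma> \<times> carrier \<Gamma>" "fst p \<in> carrier \<Gamma>" "snd p \<in> carrier \<Gamma>"
      by (auto simp: src.topspace_eq)
    show "h' p \<in> carrier (src X)"
      using g p' by (auto simp: h')
    note ev = src.eventually_pair [OF _ p'(1)]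
    \<comment> \<open>In this factor the acting element and its argument both vary with the pair, so
      local constancy of the cochains alone does not suffice.\<close>
    have "\<forall>\<^sub>F q in nhdsin (prod_topology T T) p.
        sact X (fst q) (inv\<^bsub>src X\<^esub> (a (snd q))) = sact X (fst p) (inv\<^bsub>src X\<^esub> (a (snd p)))"
      using p p' ev(2) [OF a]
      by (intro src.eventually_act) (auto simp: continuous_map_fst elim: eventually_mono)
    with ev(1) [OF a] ev(3) [OF a] ev(1) [OF \<psi>] cmaps_eventually [OF h p]
      src.eventually_in_carrier_pair [of p]
    show "\<forall>\<^sub>F q in nhdsin (prod_topology T T) p. h' q = h' p"
      by eventually_elim (use p' in \<open>auto simp add: h'\<close>)
  qed (simp add: h' src.topspace_eq)
qed

lemma Z1_act_closed:
  assumes z: "(h, \<psi>) \<in> Z1 \<Gamma> T X" and ag: "(a, g) \<in> carrier (C0 \<Gamma> T X)"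
    and act: "Z1_act \<Gamma> X (a, g) (h, \<psi>) = (h', \<psi>')"
  shows "(h', \<psi>') \<in> Z1 \<Gamma> T X"
proof -
  have h': "h' (\<sigma>, \<tau>) = xact X (inv\<^bsub>tgt X\<^esub> g)
        (a (\<sigma> \<otimes>\<^bsub>\<Gamma>\<^esub> \<tau>) \<otimes>\<^bsub>src X\<^esub> h (\<sigma>, \<tau>)
           \<otimes>\<^bsub>src X\<^esub> xact X (\<psi> \<sigma>) (sact X \<sigma> (inv\<^bsub>src X\<^esub> (a \<tau>)))
           \<otimes>\<^bsub>src X\<^esub> inv\<^bsub>src X\<^esub> (a \<sigma>))" if "\<sigma> \<in> carrier \<Gamma>" "\<tau> \<in> carrier \<Gamma>" for \<sigma> \<tau>
    using act that by (auto simp: Z1_act_def)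
  have \<psi>': "\<psi>' \<sigma> = inv\<^bsub>tgt X\<^esub> g \<otimes>\<^bsub>tgt X\<^esub> bdry X (a \<sigma>) \<otimes>\<^bsub>tgt X\<^esub> \<psi> \<sigma> \<otimes>\<^bsub>tgt X\<^esub> tact X \<sigma> g"
    if "\<sigma> \<in> carrier \<Gamma>" for \<sigma>
    using act that by (auto simp: Z1_act_def)
  note closed [simp] = Z1_closed [OF z]
  have [simp]: "a \<sigma> \<in> carrier (src X)" if "\<sigma> \<in> carrier \<Gamma>" for \<sigma>
    using that ag cmaps_closed [of a T "src X" \<sigma>] by (auto simp: C0_def src.topspace_eq)
  have [simp]: "g \<in> carrier (tgt X)"
    using ag by (simp add: C0_def)
  have cond: "\<psi> (\<sigma> \<otimes>\<^bsub>\<Gamma>\<^esub> \<tau>) = bdry X (h (\<sigma>, \<tau>)) \<otimes>\<^bsub>tgt X\<^esub> (\<psi> \<sigma> \<otimes>\<^bsub>tgt X\<^esub> tact X \<sigma> (\<psi> \<tau>))"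
    if "\<sigma> \<in> carrier \<Gamma>" "\<tau> \<in> carrier \<Gamma>" for \<sigma> \<tau>
    using z that by (subst Z1_cond_iff(1) [symmetric]) (auto simp: Z1_def)
  \<comment> \<open>Solved for its first term, the second cocycle condition is a rewrite rule that
    eliminates \<open>h\<close> at a pair whose second entry is a product.\<close>
  have coc: "h (\<sigma>, \<tau> \<otimes>\<^bsub>\<Gamma>\<^esub> \<upsilon>) = h (\<sigma> \<otimes>\<^bsub>\<Gamma>\<^esub> \<tau>, \<upsilon>) \<otimes>\<^bsub>src X\<^esub> h (\<sigma>, \<tau>) \<otimes>\<^bsub>src X\<^esub>
      inv\<^bsub>src X\<^esub> (xact X (\<psi> \<sigma>) (sact X \<sigma> (h (\<tau>, \<upsilon>))))"
    if "\<sigma> \<in> carrier \<Gamma>" "\<tau> \<in> carrier \<Gamma>" "\<upsilon> \<in> carrier \<Gamma>" for \<sigma> \<tau> \<upsilon>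
    using z that A.inv_solve_right [of "h (\<sigma>, \<tau> \<otimes>\<^bsub>\<Gamma>\<^esub> \<upsilon>)"] by (auto simp: Z1_def)
  have "\<psi>' \<sigma> \<otimes>\<^bsub>tgt X\<^esub> tact X \<sigma> (\<psi>' \<tau>) = inv\<^bsub>tgt X\<^esub> (bdry X (h' (\<sigma>, \<tau>))) \<otimes>\<^bsub>tgt X\<^esub> \<psi>' (\<sigma> \<otimes>\<^bsub>\<Gamma>\<^esub> \<tau>)"
    if "\<sigma> \<in> carrier \<Gamma>" "\<tau> \<in> carrier \<Gamma>" for \<sigma> \<tau>
    using that by (simp add: h' \<psi>' cond Gamma_simps)
  \<comment> \<open>Here \<open>src.m_assoc\<close> is associativity in \<Gamma>, which identifies
    the values at the triple product; \<open>cond\<close> and \<open>coc\<close> leave equal words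
    on both sides.\<close>
  moreover have "h' (\<sigma>, \<tau> \<otimes>\<^bsub>\<Gamma>\<^esub> \<upsilon>) \<otimes>\<^bsub>src X\<^esub> xact X (\<psi>' \<sigma>) (sact X \<sigma> (h' (\<tau>, \<upsilon>))) =
        h' (\<sigma> \<otimes>\<^bsub>\<Gamma>\<^esub> \<tau>, \<upsilon>) \<otimes>\<^bsub>src X\<^esub> h' (\<sigma>, \<tau>)"
    if "\<sigma> \<in> carrier \<Gamma>" "\<tau> \<in> carrier \<Gamma>" "\<upsilon> \<in> carrier \<Gamma>" for \<sigma> \<tau> \<upsilon>
    using that by (simp add: h' \<psi>' src.m_assoc coc cond Gamma_simps)
  moreover have "h' \<in> cmaps (prod_topology T T) (src X)" "\<psi>' \<in> cmaps T (tgt X)"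
    using cmaps_Z1_act [OF _ _ _ _ act] z ag by (auto simp: Z1_def C0_def)
  ultimately show ?thesis
    by (simp add: Z1_def)
qed

lemma Z1_right_action: "right_action (C0 \<Gamma> T X) (Z1 \<Gamma> T X) (Z1_act \<Gamma> X)"
proof -
  interpret C0: group "C0 \<Gamma> T X" by (rule group_C0)
  show ?thesis
  proof unfold_locales
    fix c z assume "c \<in> carrier (C0 \<Gamma> T X)" "z \<in> Z1 \<Gamma> T X"
    then show "Z1_act \<Gamma> X c z \<in> Z1 \<Gamma> T X"
      using Z1_act_closed by (metis surj_pair)
  next
    fix z assume z: "z \<in> Z1 \<Gamma> T X"
    obtain h \<psi> where [simp]: "z = (h, \<psi>)" by (cases z)
    note [simp] = Z1_closed [OF z [simplified]]
    have "h \<in> extensional (carrier \<Gamma> \<times> carrier \<Gamma>)" "\<psi> \<in> extensional (carrier \<Gamma>)"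
      using z Z1_extensional by simp_all
    then show "Z1_act \<Gamma> X \<one>\<^bsub>C0 \<Gamma> T X\<^esub> z = z"
      by (auto simp: Z1_act_def C0_def extensional_def fun_eq_iff)
  next
    fix c d z assume cd: "c \<in> carrier (C0 \<Gamma> T X)" "d \<in> carrier (C0 \<Gamma> T X)" and z: "z \<in> Z1 \<Gamma> T X"
    obtain a g b k h \<psi> where [simp]: "c = (a, g)" "d = (b, k)" "z = (h, \<psi>)"
      by (cases c, cases d, cases z)
    note [simp] = Z1_closed [OF z [simplified]]
    have [simp]: "a \<sigma> \<in> carrier (src X)" "b \<sigma> \<in> carrier (src X)" if "\<sigma> \<in> carrier \<Gamma>" for \<sigma>
      using that cd cmaps_closed [of _ T "src X" \<sigma>] by (auto simp: C0_def src.topspace_eq)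
    have [simp]: "g \<in> carrier (tgt X)" "k \<in> carrier (tgt X)"
      using cd by (simp_all add: C0_def)
    show "Z1_act \<Gamma> X (c \<otimes>\<^bsub>C0 \<Gamma> T X\<^esub> d) z = Z1_act \<Gamma> X d (Z1_act \<Gamma> X c z)"
      by (auto simp: Z1_act_def C0_def Gamma_simps fun_eq_iff)
  qed
qed

text \<open>Elements \<open>(a, bdry f)\<close> of \<open>C0\<close> can be traded for elements \<open>(b, 1)\<close> without changing their effect on a
  given cocycle. Hence, by the decomposition of the target, only elements whose second component
  comes from the source of the quasi-isomorphism have to be considered in the proof of injectivity
  on \<open>H1\<close>.\<close>

lemma Z1_act_bdry:
  assumes z: "(h, \<psi>) \<in> Z1 \<Gamma> T X" and a: "a \<in> cmaps T (src X)"
    and f: "f \<in> carrier (src X)" and g: "g \<in> carrier (tgt X)"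
  obtains b where "b \<in> cmaps T (src X)"
    and "Z1_act \<Gamma> X (a, bdry X f \<otimes>\<^bsub>tgt X\<^esub> g) (h, \<psi>) = Z1_act \<Gamma> X (b, g) (h, \<psi>)"
proof
  \<comment> \<open>The choice is dictated by the \<psi>-component: moving \<open>bdry X f\<close>
    and its \<Gamma>-translate to the left of \<open>\<psi> \<sigma>\<close> turns the translate
    into the boundary of \<open>xact X (\<psi> \<sigma>) (sact X \<sigma> f)\<close>.\<close>
  define b where "b = (\<lambda>\<sigma>\<in>carrier \<Gamma>. inv\<^bsub>src X\<^esub> f \<otimes>\<^bsub>src X\<^esub> a \<sigma> \<otimes>\<^bsub>src X\<^esub> xact X (\<psi> \<sigma>) (sact X \<sigma> f))"
  note [simp] = Z1_closed [OF z] f g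
  have a_closed [simp]: "a \<sigma> \<in> carrier (src X)" if "\<sigma> \<in> carrier \<Gamma>" for \<sigma>
    using that cmaps_closed [OF a] by (auto simp: src.topspace_eq)
  show "b \<in> cmaps T (src X)"
  proof (rule cmapsI)
    fix \<sigma> assume \<sigma>: "\<sigma> \<in> topspace T"
    then show "b \<sigma> \<in> carrier (src X)"
      by (simp add: b_def src.topspace_eq)
    have \<psi>: "\<psi> \<in> cmaps T (tgt X)"
      using z by (simp add: Z1_def)
    have "\<forall>\<^sub>F \<tau> in nhdsin T \<sigma>. sact X \<tau> f = sact X \<sigma> f"
      using src.eventually_act [of T "\<lambda>\<sigma>. \<sigma>" \<sigma> "\<lambda>\<sigma>. f"] \<sigma> by simp
    with cmaps_eventually [OF a \<sigma>] cmaps_eventually [OF \<psi> \<sigma>] src.eventually_in_carrier [of \<sigma>]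
    show "\<forall>\<^sub>F \<tau> in nhdsin T \<sigma>. b \<tau> = b \<sigma>"
      by eventually_elim (use \<sigma> in \<open>simp add: b_def src.topspace_eq\<close>)
  qed (simp add: b_def src.topspace_eq)
  \<comment> \<open>The value of \<open>b\<close> at a product involves the action of \<psi> at that
    product. After this rewriting it becomes the action of the two factors followed by conjugation
    by \<open>h (\<sigma>, \<tau>)\<close>.\<close>
  have cond: "\<psi> (\<sigma> \<otimes>\<^bsub>\<Gamma>\<^esub> \<tau>) = bdry X (h (\<sigma>, \<tau>)) \<otimes>\<^bsub>tgt X\<^esub> (\<psi> \<sigma> \<otimes>\<^bsub>tgt X\<^esub> tact X \<sigma> (\<psi> \<tau>))"
    if "\<sigma> \<in> carrier \<Gamma>" "\<tau> \<in> carrier \<Gamma>" for \<sigma> \<tau>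
    using z that by (subst Z1_cond_iff(1) [symmetric]) (auto simp: Z1_def)
  show "Z1_act \<Gamma> X (a, bdry X f \<otimes>\<^bsub>tgt X\<^esub> g) (h, \<psi>) = Z1_act \<Gamma> X (b, g) (h, \<psi>)"
    by (auto simp: Z1_act_def b_def fun_eq_iff cond Gamma_simps)
qed

end

section \<open>Morphisms on cocycles\<close>

context Gamma_xmod_morphism
begin

sublocale e: group_hom "src X" "src Y" e
  by unfold_locales (rule src_hom)

sublocale e': group_hom "tgt X" "tgt Y" e'
  by unfold_locales (rule tgt_hom)

lemmas morphism_simps = src_equivariant tgt_equivariant square xact_compat

text \<open>Elements of \<open>C0\<close> have the same shape as cocycles in degree 0; the map is
  used on both.\<close>

definition Z0_map :: "('s \<Rightarrow> 'f1) \<times> 'g1 \<Rightarrow> ('s \<Rightarrow> 'f2) \<times> 'g2" where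
  "Z0_map = (\<lambda>(\<phi>, g). (compose (carrier \<Gamma>) e \<phi>, e' g))"

definition Z1_map :: "('s \<times> 's \<Rightarrow> 'f1) \<times> ('s \<Rightarrow> 'g1) \<Rightarrow> ('s \<times> 's \<Rightarrow> 'f2) \<times> ('s \<Rightarrow> 'g2)" where
  "Z1_map = (\<lambda>(h, \<psi>). (compose (carrier \<Gamma> \<times> carrier \<Gamma>) e h, compose (carrier \<Gamma>) e' \<psi>))"

lemma cmaps_compose_src: "\<phi> \<in> cmaps T (src X) \<Longrightarrow> compose (carrier \<Gamma>) e \<phi> \<in> cmaps T (src Y)"
  using cmaps_compose [of \<phi> T "src X" e "src Y"] by (simp add: X.src.topspace_eq)

lemma Z0_map_closed:
  assumes "z \<in> Z0 \<Gamma> T X"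
  shows "Z0_map z \<in> Z0 \<Gamma> T Y"
proof -
  obtain \<phi> g where [simp]: "z = (\<phi>, g)" by (cases z)
  note [simp] = X.Z0_closed [OF assms [simplified]]
  have "\<phi> (\<sigma> \<otimes>\<^bsub>\<Gamma>\<^esub> \<tau>) = \<phi> \<sigma> \<otimes>\<^bsub>src X\<^esub> sact X \<sigma> (\<phi> \<tau>)" if "\<sigma> \<in> carrier \<Gamma>" "\<tau> \<in> carrier \<Gamma>" for \<sigma> \<tau>
    using assms that by (simp add: Z0_def)
  moreover have "tact X \<sigma> g = inv\<^bsub>tgt X\<^esub> (bdry X (\<phi> \<sigma>)) \<otimes>\<^bsub>tgt X\<^esub> g" if "\<sigma> \<in> carrier \<Gamma>" for \<sigma>
    using assms that by (simp add: Z0_def)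
  moreover have "\<phi> \<in> cmaps T (src X)"
    using assms by (simp add: Z0_def)
  ultimately show ?thesis
    by (simp add: Z0_map_def Z0_def cmaps_compose_src [unfolded compose_def] compose_def morphism_simps
      flip: src_equivariant tgt_equivariant)
qed

lemma Z0_map_act:
  assumes "f \<in> carrier (src X)" "z \<in> Z0 \<Gamma> T X"
  shows "Z0_map (Z0_act \<Gamma> X f z) = Z0_act \<Gamma> Y (e f) (Z0_map z)"
proof -
  obtain \<phi> g where [simp]: "z = (\<phi>, g)" by (cases z)
  note [simp] = X.Z0_closed [OF assms(2) [simplified]]
  show ?thesis
    using assms(1) by (auto simp: Z0_map_def Z0_act_def compose_def fun_eq_iff morphism_simps)
qed

lemma Z1_map_closed:
  assumes "z \<in> Z1 \<Gamma> T X"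
  shows "Z1_map z \<in> Z1 \<Gamma> T Y"
proof -
  obtain h \<psi> where [simp]: "z = (h, \<psi>)" by (cases z)
  note [simp] = X.Z1_closed [OF assms [simplified]]
  have "\<psi> \<sigma> \<otimes>\<^bsub>tgt X\<^esub> tact X \<sigma> (\<psi> \<tau>) = inv\<^bsub>tgt X\<^esub> (bdry X (h (\<sigma>, \<tau>))) \<otimes>\<^bsub>tgt X\<^esub> \<psi> (\<sigma> \<otimes>\<^bsub>\<Gamma>\<^esub> \<tau>)"
    if "\<sigma> \<in> carrier \<Gamma>" "\<tau> \<in> carrier \<Gamma>" for \<sigma> \<tau>
    using assms that by (simp add: Z1_def)
  from arg_cong [OF this, where f = e']
  have 1: "e' (\<psi> \<sigma>) \<otimes>\<^bsub>tgt Y\<^esub> tact Y \<sigma> (e' (\<psi> \<tau>)) =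
      inv\<^bsub>tgt Y\<^esub> (bdry Y (e (h (\<sigma>, \<tau>)))) \<otimes>\<^bsub>tgt Y\<^esub> e' (\<psi> (\<sigma> \<otimes>\<^bsub>\<Gamma>\<^esub> \<tau>))"
    if "\<sigma> \<in> carrier \<Gamma>" "\<tau> \<in> carrier \<Gamma>" for \<sigma> \<tau>
    using that by (simp add: morphism_simps)
  have "h (\<sigma>, \<tau> \<otimes>\<^bsub>\<Gamma>\<^esub> \<upsilon>) \<otimes>\<^bsub>src X\<^esub> xact X (\<psi> \<sigma>) (sact X \<sigma> (h (\<tau>, \<upsilon>))) =
        h (\<sigma> \<otimes>\<^bsub>\<Gamma>\<^esub> \<tau>, \<upsilon>) \<otimes>\<^bsub>src X\<^esub> h (\<sigma>, \<tau>)"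
    if "\<sigma> \<in> carrier \<Gamma>" "\<tau> \<in> carrier \<Gamma>" "\<upsilon> \<in> carrier \<Gamma>" for \<sigma> \<tau> \<upsilon>
    using assms that by (simp add: Z1_def)
  from arg_cong [OF this, where f = e]
  have 2: "e (h (\<sigma>, \<tau> \<otimes>\<^bsub>\<Gamma>\<^esub> \<upsilon>)) \<otimes>\<^bsub>src Y\<^esub> xact Y (e' (\<psi> \<sigma>)) (sact Y \<sigma> (e (h (\<tau>, \<upsilon>)))) =
        e (h (\<sigma> \<otimes>\<^bsub>\<Gamma>\<^esub> \<tau>, \<upsilon>)) \<otimes>\<^bsub>src Y\<^esub> e (h (\<sigma>, \<tau>))"
    if "\<sigma> \<in> carrier \<Gamma>" "\<tau> \<in> carrier \<Gamma>" "\<upsilon> \<in> carrier \<Gamma>" for \<sigma> \<tau> \<upsilon>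
    using that by (simp add: morphism_simps)
  have "compose (carrier \<Gamma> \<times> carrier \<Gamma>) e h \<in> cmaps (prod_topology T T) (src Y)"
    "compose (carrier \<Gamma>) e' \<psi> \<in> cmaps T (tgt Y)"
    using assms cmaps_compose [of h "prod_topology T T" "src X" e "src Y"]
      cmaps_compose [of \<psi> T "tgt X" e' "tgt Y"]
    by (simp_all add: Z1_def X.src.topspace_eq)
  then show ?thesis
    by (simp add: Z1_map_def Z1_def compose_def 1 2)
qed

lemma Z1_map_act:
  assumes "(a, g) \<in> carrier (C0 \<Gamma> T X)" "z \<in> Z1 \<Gamma> T X"
  shows "Z1_map (Z1_act \<Gamma> X (a, g) z) = Z1_act \<Gamma> Y (Z0_map (a, g)) (Z1_map z)"
proof -
  obtain h \<psi> where [simp]: "z = (h, \<psi>)" by (cases z)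
  note [simp] = X.Z1_closed [OF assms(2) [simplified]]
  have [simp]: "a \<sigma> \<in> carrier (src X)" if "\<sigma> \<in> carrier \<Gamma>" for \<sigma>
    using that assms(1) cmaps_closed [of a T "src X" \<sigma>] by (auto simp: C0_def X.src.topspace_eq)
  have [simp]: "g \<in> carrier (tgt X)"
    using assms(1) by (simp add: C0_def)
  show ?thesis
    by (auto simp: Z0_map_def Z1_map_def Z1_act_def compose_def fun_eq_iff morphism_simps)
qed

end

section \<open>Quasi-isomorphisms\<close>

context crossed_module
begin

lemma im_bdry_subgroup: "subgroup (im_bdry X) (tgt X)"
  unfolding im_bdry_def by (rule bdry.img_is_subgroup)

lemma carrier_coker_bdry:
  "carrier (coker_bdry X) = (\<lambda>g. im_bdry X #>\<^bsub>tgt X\<^esub> g) ` carrier (tgt X)"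
  by (auto simp: coker_bdry_def FactGroup_def RCOSETS_def)

lemma coset_im_bdry_eq_iff:
  assumes "g \<in> carrier (tgt X)" "g' \<in> carrier (tgt X)"
  shows "im_bdry X #>\<^bsub>tgt X\<^esub> g = im_bdry X #>\<^bsub>tgt X\<^esub> g' \<longleftrightarrow>
    (\<exists>f\<in>carrier (src X). g = bdry X f \<otimes>\<^bsub>tgt X\<^esub> g')"
proof -
  have "im_bdry X #>\<^bsub>tgt X\<^esub> g = im_bdry X #>\<^bsub>tgt X\<^esub> g' \<longleftrightarrow> g \<in> im_bdry X #>\<^bsub>tgt X\<^esub> g'"
    using assms H.rcos_self H.repr_independence im_bdry_subgroup by metis
  then show ?thesis
    by (auto simp: r_coset_def im_bdry_def)
qed

end

text \<open>Changing the representative by \<open>bdry X f\<close> changes its image by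
  \<open>bdry Y (e f)\<close>, so all cosets in the union are equal.\<close>

lemma (in Gamma_xmod_morphism) coker_map_coset:
  assumes "g \<in> carrier (tgt X)"
  shows "coker_map Y e' (im_bdry X #>\<^bsub>tgt X\<^esub> g) = im_bdry Y #>\<^bsub>tgt Y\<^esub> e' g"
proof -
  have eq: "im_bdry Y #>\<^bsub>tgt Y\<^esub> e' k = im_bdry Y #>\<^bsub>tgt Y\<^esub> e' g" if k: "k \<in> im_bdry X #>\<^bsub>tgt X\<^esub> g" for k
  proof -
    obtain f where "f \<in> carrier (src X)" "k = bdry X f \<otimes>\<^bsub>tgt X\<^esub> g"
      using k by (auto simp: r_coset_def im_bdry_def)
    then have "e' k = bdry Y (e f) \<otimes>\<^bsub>tgt Y\<^esub> e' g" "e f \<in> carrier (src Y)" "k \<in> carrier (tgt X)"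
      using assms by (simp_all add: square)
    then show ?thesis
      using assms by (subst Y.coset_im_bdry_eq_iff) auto
  qed
  have "coker_map Y e' (im_bdry X #>\<^bsub>tgt X\<^esub> g) = (\<Union>k\<in>im_bdry X #>\<^bsub>tgt X\<^esub> g. im_bdry Y #>\<^bsub>tgt Y\<^esub> e' g)"
    unfolding coker_map_def by (rule SUP_cong [OF refl eq])
  then show ?thesis
    using X.H.rcos_self [OF assms X.im_bdry_subgroup] by (metis UN_constant empty_iff)
qed

section \<open>The fibre product property and the bijections on hypercohomology\<close>

context Gamma_xmod_quasi_iso
begin

text \<open>This is surjectivity on cokernels, expressed by representatives.\<close>

lemma tgt_decomp:
  assumes "g \<in> carrier (tgt Y)"
  obtains f k where "f \<in> carrier (src Y)" "k \<in> carrier (tgt X)" "g = bdry Y f \<otimes>\<^bsub>tgt Y\<^esub> e' k"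
proof -
  have "im_bdry Y #>\<^bsub>tgt Y\<^esub> g \<in> coker_map Y e' ` carrier (coker_bdry X)"
    using coker_iso assms by (simp add: iso_def bij_betw_def Y.carrier_coker_bdry)
  then obtain k where "k \<in> carrier (tgt X)" "im_bdry Y #>\<^bsub>tgt Y\<^esub> g = im_bdry Y #>\<^bsub>tgt Y\<^esub> e' k"
    by (auto simp: X.carrier_coker_bdry coker_map_coset)
  with assms that show thesis
    using Y.coset_im_bdry_eq_iff by auto
qed

text \<open>The class of \<open>g\<close> maps to the trivial class, so it is trivial by injectivity
  on cokernels.\<close>

lemma bdry_preimage:
  assumes "g \<in> carrier (tgt X)" "f \<in> carrier (src Y)" "e' g = bdry Y f"
  obtains k where "k \<in> carrier (src X)" "g = bdry X k"
proof -
  have "im_bdry Y #>\<^bsub>tgt Y\<^esub> e' g = im_bdry Y #>\<^bsub>tgt Y\<^esub> e' \<one>\<^bsub>tgt X\<^esub>"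
    using assms by (subst Y.coset_im_bdry_eq_iff) auto
  then have "coker_map Y e' (im_bdry X #>\<^bsub>tgt X\<^esub> g) = coker_map Y e' (im_bdry X #>\<^bsub>tgt X\<^esub> \<one>\<^bsub>tgt X\<^esub>)"
    using assms(1) by (simp only: coker_map_coset X.H.one_closed)
  moreover have "inj_on (coker_map Y e') (carrier (coker_bdry X))"
    using coker_iso by (simp add: iso_def bij_betw_def)
  ultimately have "im_bdry X #>\<^bsub>tgt X\<^esub> g = im_bdry X #>\<^bsub>tgt X\<^esub> \<one>\<^bsub>tgt X\<^esub>"
    using assms(1) by (auto simp: inj_on_def X.carrier_coker_bdry)
  then show thesis
    using that assms(1) X.coset_im_bdry_eq_iff [of g "\<one>\<^bsub>tgt X\<^esub>"] by auto
qed

lemma ker_bij: "bij_betw e (kernel (src X) (tgt X) (bdry X)) (kernel (src Y) (tgt Y) (bdry Y))"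
  using ker_iso by (simp add: iso_def ker_bdry_def)

text \<open>The quotient of the two elements lies in the kernel of the boundary, where
  \<open>e\<close> is injective, and is sent to 1. This is uniqueness in the fibre product
  property.\<close>

lemma src_eqI:
  assumes "k \<in> carrier (src X)" "k' \<in> carrier (src X)" "bdry X k = bdry X k'" "e k = e k'"
  shows "k = k'"
proof -
  have "k \<otimes>\<^bsub>src X\<^esub> inv\<^bsub>src X\<^esub> k' \<in> kernel (src X) (tgt X) (bdry X)"
    "\<one>\<^bsub>src X\<^esub> \<in> kernel (src X) (tgt X) (bdry X)"
    "e (k \<otimes>\<^bsub>src X\<^esub> inv\<^bsub>src X\<^esub> k') = e \<one>\<^bsub>src X\<^esub>"
    using assms by (simp_all add: kernel_def)
  then have "k \<otimes>\<^bsub>src X\<^esub> inv\<^bsub>src X\<^esub> k' = \<one>\<^bsub>src X\<^esub>"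
    using ker_bij unfolding bij_betw_def by (meson inj_onD)
  then show ?thesis
    using assms X.A.inv_solve_right' [of "\<one>\<^bsub>src X\<^esub>" k k'] by simp
qed

text \<open>A quasi-isomorphism makes the square of \<open>bdry X\<close>, \<open>bdry Y\<close>, \<open>e\<close> and \<open>e'\<close> cartesian; this
  gives the map from the fibre product back to the source of \<open>X\<close>.\<close>

definition lift where
  "lift g f = (SOME k. k \<in> carrier (src X) \<and> bdry X k = g \<and> e k = f)"

text \<open>Injectivity on cokernels gives some \<open>k\<close> over \<open>g\<close>; its image
  differs from \<open>f\<close> by an element of the kernel of \<open>bdry Y\<close>, and
  surjectivity on kernels corrects \<open>k\<close>. Since \<open>lift\<close> is a function of
  \<open>g\<close> and \<open>f\<close> only, locally constant data have locally constant
  lifts.\<close>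

lemma lift:
  assumes "g \<in> carrier (tgt X)" "f \<in> carrier (src Y)" "bdry Y f = e' g"
  shows "lift g f \<in> carrier (src X)" "bdry X (lift g f) = g" "e (lift g f) = f"
proof -
  obtain k where k: "k \<in> carrier (src X)" "g = bdry X k"
    using bdry_preimage [of g f] assms by auto
  then have "inv\<^bsub>src Y\<^esub> (e k) \<otimes>\<^bsub>src Y\<^esub> f \<in> kernel (src Y) (tgt Y) (bdry Y)"
    using assms by (simp add: kernel_def square)
  then obtain l where l: "l \<in> carrier (src X)" "bdry X l = \<one>\<^bsub>tgt X\<^esub>" "inv\<^bsub>src Y\<^esub> (e k) \<otimes>\<^bsub>src Y\<^esub> f = e l"
    using ker_bij by (auto simp: bij_betw_def kernel_def)
  have "f = e k \<otimes>\<^bsub>src Y\<^esub> e l"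
    using k l assms by (simp flip: l(3) add: Y.A.inv_mult_cancel)
  then have "k \<otimes>\<^bsub>src X\<^esub> l \<in> carrier (src X) \<and> bdry X (k \<otimes>\<^bsub>src X\<^esub> l) = g \<and> e (k \<otimes>\<^bsub>src X\<^esub> l) = f"
    using k l by simp
  then have "lift g f \<in> carrier (src X) \<and> bdry X (lift g f) = g \<and> e (lift g f) = f"
    unfolding lift_def by (rule someI)
  then show "lift g f \<in> carrier (src X)" "bdry X (lift g f) = g" "e (lift g f) = f"
    by blast+
qed

section \<open>Degree -1\<close>

lemma bij_Hm1: "bij_betw e (Hm1 \<Gamma> X) (Hm1 \<Gamma> Y)"
proof -
  have inj: "inj_on e (kernel (src X) (tgt X) (bdry X))"
    and im: "e ` kernel (src X) (tgt X) (bdry X) = kernel (src Y) (tgt Y) (bdry Y)"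
    using ker_bij by (simp_all add: bij_betw_def)
  \<comment> \<open>Bijectivity on kernels is known, so invariance has to be reflected:
    \<open>sact X \<sigma> f\<close> and \<open>f\<close> both have trivial boundary, and
    \<open>src_eqI\<close> applies once their images agree.\<close>
  have "(\<forall>\<sigma>\<in>carrier \<Gamma>. sact Y \<sigma> (e f) = e f) \<longleftrightarrow> (\<forall>\<sigma>\<in>carrier \<Gamma>. sact X \<sigma> f = f)"
    if "f \<in> kernel (src X) (tgt X) (bdry X)" for f
  proof -
    have f: "f \<in> carrier (src X)" "bdry X f = \<one>\<^bsub>tgt X\<^esub>"
      using that by (auto simp: kernel_def)
    have "sact Y \<sigma> (e f) = e f \<longleftrightarrow> sact X \<sigma> f = f" if "\<sigma> \<in> carrier \<Gamma>" for \<sigma>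
      using f that src_eqI [of "sact X \<sigma> f" f] by (auto simp: X.bdry_equivariant simp flip: src_equivariant)
    then show ?thesis by simp
  qed
  then have "e ` Hm1 \<Gamma> X = Hm1 \<Gamma> Y"
    unfolding Hm1_def ker_bdry_def by (auto simp flip: im)
  with inj show ?thesis
    by (auto simp: bij_betw_def Hm1_def ker_bdry_def inj_on_def)
qed

text \<open>By \<open>Z0_bdry\<close>, equal second components give equal boundaries of the first
  components, and \<open>src_eqI\<close> applies at each \<sigma>.\<close>

lemma Z0_eqI:
  assumes "z \<in> Z0 \<Gamma> T X" "z' \<in> Z0 \<Gamma> T X" "Z0_map z = Z0_map z'" "snd z = snd z'"
  shows "z = z'"
proof -
  obtain \<phi> \<phi>' g where [simp]: "z = (\<phi>, g)" "z' = (\<phi>', g)"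
    using assms(4) by (cases z, cases z') auto
  have "\<phi> = \<phi>'"
  proof (rule extensionalityI [of _ "carrier \<Gamma>"])
    show "\<phi> \<in> extensional (carrier \<Gamma>)" "\<phi>' \<in> extensional (carrier \<Gamma>)"
      using assms(1,2) X.Z0_extensional by simp_all
    fix \<sigma> assume \<sigma>: "\<sigma> \<in> carrier \<Gamma>"
    have "compose (carrier \<Gamma>) e \<phi> \<sigma> = compose (carrier \<Gamma>) e \<phi>' \<sigma>"
      using assms(3) by (simp add: Z0_map_def)
    with \<sigma> show "\<phi> \<sigma> = \<phi>' \<sigma>"
      using assms(1,2) X.Z0_closed X.Z0_bdry by (intro src_eqI) (auto simp: compose_def)
  qed
  then show ?thesis by simp
qed

text \<open>By \<open>Z1_bdry\<close> the boundary of \<open>h\<close> is a function of \<psi>, so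
  \<open>src_eqI\<close> applies at each pair. In the injectivity proof this spares any computation
  with the \<open>h\<close>-component.\<close>

lemma Z1_eqI:
  assumes "z \<in> Z1 \<Gamma> T X" "z' \<in> Z1 \<Gamma> T X" "Z1_map z = Z1_map z'" "snd z = snd z'"
  shows "z = z'"
proof -
  obtain h h' \<psi> where [simp]: "z = (h, \<psi>)" "z' = (h', \<psi>)"
    using assms(4) by (cases z, cases z') auto
  have "h = h'"
  proof (rule extensionalityI [of _ "carrier \<Gamma> \<times> carrier \<Gamma>"])
    show "h \<in> extensional (carrier \<Gamma> \<times> carrier \<Gamma>)" "h' \<in> extensional (carrier \<Gamma> \<times> carrier \<Gamma>)"
      using assms(1,2) X.Z1_extensional by simp_all
    fix p assume "p \<in> carrier \<Gamma> \<times> carrier \<Gamma>"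
    then obtain \<sigma> \<tau> where p: "p = (\<sigma>, \<tau>)" "\<sigma> \<in> carrier \<Gamma>" "\<tau> \<in> carrier \<Gamma>" by auto
    have "compose (carrier \<Gamma> \<times> carrier \<Gamma>) e h p = compose (carrier \<Gamma> \<times> carrier \<Gamma>) e h' p"
      using assms(3) by (simp add: Z1_map_def)
    with p show "h p = h' p"
      using assms(1,2) X.Z1_closed X.Z1_bdry by (intro src_eqI) (auto simp: compose_def)
  qed
  then show ?thesis by simp
qed

section \<open>Degree 0\<close>

lemma Z0_map_inj:
  assumes z: "z \<in> Z0 \<Gamma> T X" "z' \<in> Z0 \<Gamma> T X" and f: "f \<in> carrier (src Y)"
    and eq: "Z0_map z' = Z0_act \<Gamma> Y f (Z0_map z)"
  shows "\<exists>k\<in>carrier (src X). z' = Z0_act \<Gamma> X k z"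
proof -
  obtain \<phi> g \<phi>' g' where z_eq [simp]: "z = (\<phi>, g)" "z' = (\<phi>', g')" by (cases z, cases z')
  have [simp]: "g \<in> carrier (tgt X)" "g' \<in> carrier (tgt X)"
    using z X.Z0_closed by auto
  have "e' g' = inv\<^bsub>tgt Y\<^esub> (bdry Y f) \<otimes>\<^bsub>tgt Y\<^esub> e' g"
    using eq by (simp add: Z0_map_def Z0_act_def)
  \<comment> \<open>The equation of the second components shows that \<open>f\<close> lies over
    \<open>g \<otimes> inv g'\<close>, so it lifts to the required element of
    \<open>src X\<close>.\<close>
  then have "bdry Y f = e' (g \<otimes>\<^bsub>tgt X\<^esub> inv\<^bsub>tgt X\<^esub> g')"
    using f by (simp add: Y.H.word_simps)
  note k = lift [OF X.H.m_closed [OF \<open>g \<in> carrier (tgt X)\<close> X.H.inv_closed] f this,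
      OF \<open>g' \<in> carrier (tgt X)\<close>]
  let ?k = "lift (g \<otimes>\<^bsub>tgt X\<^esub> inv\<^bsub>tgt X\<^esub> g') f"
  have "z' = Z0_act \<Gamma> X ?k z"
  proof (rule Z0_eqI [symmetric, OF right_action.act_closed [OF X.Z0_right_action k(1) z(1)] z(2)])
    show "Z0_map (Z0_act \<Gamma> X ?k z) = Z0_map z'"
      using Z0_map_act [OF _ z(1)] k eq by simp
    show "snd (Z0_act \<Gamma> X ?k z) = snd z'"
      using k by (simp add: Z0_act_def X.H.word_simps)
  qed
  with k(1) show ?thesis by blast
qed

lemma Z0_map_surj:
  assumes w: "w \<in> Z0 \<Gamma> T Y"
  shows "\<exists>f\<in>carrier (src Y). \<exists>z\<in>Z0 \<Gamma> T X. Z0_map z = Z0_act \<Gamma> Y f w"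
proof -
  obtain \<phi> g where w_eq: "w = (\<phi>, g)" by (cases w)
  obtain f k where f: "f \<in> carrier (src Y)" and k: "k \<in> carrier (tgt X)"
    and g: "g = bdry Y f \<otimes>\<^bsub>tgt Y\<^esub> e' k"
    using w tgt_decomp Y.Z0_closed(1) unfolding w_eq by metis
  \<comment> \<open>Acting by \<open>f\<close> cancels the factor \<open>bdry Y f\<close> of
    \<open>g\<close>, leaving a cocycle over \<open>e' k\<close>.\<close>
  obtain \<phi>' where act: "Z0_act \<Gamma> Y f w = (\<phi>', e' k)"
    using f k by (simp add: w_eq Z0_act_def g Y.H.word_simps)
  have w': "(\<phi>', e' k) \<in> Z0 \<Gamma> T Y"
    using right_action.act_closed [OF Y.Z0_right_action f w] by (simp add: act)
  note [simp] = Y.Z0_closed [OF w'] k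
  have \<phi>': "\<phi>' \<in> cmaps T (src Y)"
    and coc: "\<And>\<sigma> \<tau>. \<lbrakk>\<sigma> \<in> carrier \<Gamma>; \<tau> \<in> carrier \<Gamma>\<rbrakk> \<Longrightarrow> \<phi>' (\<sigma> \<otimes>\<^bsub>\<Gamma>\<^esub> \<tau>) = \<phi>' \<sigma> \<otimes>\<^bsub>src Y\<^esub> sact Y \<sigma> (\<phi>' \<tau>)"
    using w' by (auto simp: Z0_def)
  \<comment> \<open>The prescribed boundary is the one that \<open>Z0_bdry\<close> forces on a
    cocycle with second component \<open>k\<close>.\<close>
  define \<theta> where "\<theta> = (\<lambda>\<sigma>\<in>carrier \<Gamma>. lift (k \<otimes>\<^bsub>tgt X\<^esub> inv\<^bsub>tgt X\<^esub> (tact X \<sigma> k)) (\<phi>' \<sigma>))"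
  have \<theta> [simp]: "\<theta> \<sigma> \<in> carrier (src X)" "bdry X (\<theta> \<sigma>) = k \<otimes>\<^bsub>tgt X\<^esub> inv\<^bsub>tgt X\<^esub> (tact X \<sigma> k)" "e (\<theta> \<sigma>) = \<phi>' \<sigma>"
    if "\<sigma> \<in> carrier \<Gamma>" for \<sigma>
    using lift [of "k \<otimes>\<^bsub>tgt X\<^esub> inv\<^bsub>tgt X\<^esub> (tact X \<sigma> k)" "\<phi>' \<sigma>"] that Y.Z0_bdry [OF w' that]
    by (simp_all add: \<theta>_def tgt_equivariant)
  have "\<theta> \<in> cmaps T (src X)"
  proof (rule cmapsI)
    fix \<sigma> assume \<sigma>: "\<sigma> \<in> topspace T"
    then show "\<theta> \<sigma> \<in> carrier (src X)"
      by (simp add: X.src.topspace_eq)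
    have "\<forall>\<^sub>F \<tau> in nhdsin T \<sigma>. tact X \<tau> k = tact X \<sigma> k"
      using X.tgt.eventually_act [of T "\<lambda>\<sigma>. \<sigma>" \<sigma> "\<lambda>\<sigma>. k"] \<sigma> by simp
    with cmaps_eventually [OF \<phi>' \<sigma>] X.src.eventually_in_carrier [of \<sigma>]
    show "\<forall>\<^sub>F \<tau> in nhdsin T \<sigma>. \<theta> \<tau> = \<theta> \<sigma>"
      by eventually_elim (use \<sigma> in \<open>simp add: \<theta>_def X.src.topspace_eq\<close>)
  qed (simp add: \<theta>_def X.src.topspace_eq)
  \<comment> \<open>Both sides have the same boundary, computed from \<open>k\<close>, and the same
    image under \<open>e\<close>, because \<open>\<phi>'\<close> is a cocycle.\<close>
  moreover have "\<theta> (\<sigma> \<otimes>\<^bsub>\<Gamma>\<^esub> \<tau>) = \<theta> \<sigma> \<otimes>\<^bsub>src X\<^esub> sact X \<sigma> (\<theta> \<tau>)" if "\<sigma> \<in> carrier \<Gamma>" "\<tau> \<in> carrier \<Gamma>" for \<sigma> \<tau>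
    using that by (intro src_eqI) (simp_all add: coc src_equivariant X.Gamma_simps)
  ultimately have z: "(\<theta>, k) \<in> Z0 \<Gamma> T X"
    by (simp add: Z0_def X.H.word_simps)
  have "compose (carrier \<Gamma>) e \<theta> = \<phi>'"
    using cmaps_extensional [OF \<phi>'] by (auto simp: compose_def fun_eq_iff extensional_def X.src.topspace_eq)
  then show ?thesis
    using f z act by (auto simp: Z0_map_def intro!: bexI [of _ f] bexI [of _ "(\<theta>, k)"])
qed

lemma bij_H0: "bij_betw (H0_map \<Gamma> Y e e') (H0 \<Gamma> T X) (H0 \<Gamma> T Y)"
proof -
  have "H0_map \<Gamma> Y e e' = (\<lambda>c. \<Union>z\<in>c. orbit (src Y) (Z0_act \<Gamma> Y) (Z0_map z))"
    by (simp add: H0_map_def Z0_map_def fun_eq_iff case_prod_unfold)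
  then show ?thesis
    unfolding H0_def
    using bij_betw_orbits [OF X.Z0_right_action Y.Z0_right_action, of e Z0_map]
      Z0_map_closed Z0_map_act Z0_map_inj Z0_map_surj by simp
qed

section \<open>Degree 1\<close>

lemma Z1_map_inj:
  assumes z: "z \<in> Z1 \<Gamma> T X" "z' \<in> Z1 \<Gamma> T X" and c: "c \<in> carrier (C0 \<Gamma> T Y)"
    and eq: "Z1_map z' = Z1_act \<Gamma> Y c (Z1_map z)"
  shows "\<exists>d\<in>carrier (C0 \<Gamma> T X). z' = Z1_act \<Gamma> X d z"
proof -
  obtain h \<psi> h' \<psi>' where z_eq [simp]: "z = (h, \<psi>)" "z' = (h', \<psi>')" by (cases z, cases z')
  note [simp] = X.Z1_closed [OF z(1) [simplified]] X.Z1_closed [OF z(2) [simplified]]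
  obtain a g where c_eq: "c = (a, g)" and a: "a \<in> cmaps T (src Y)" and "g \<in> carrier (tgt Y)"
    using c by (auto simp: C0_def)
  then obtain f k where f: "f \<in> carrier (src Y)" and k [simp]: "k \<in> carrier (tgt X)"
    and g: "g = bdry Y f \<otimes>\<^bsub>tgt Y\<^esub> e' k"
    using tgt_decomp by metis
  have "Z1_map z \<in> Z1 \<Gamma> T Y"
    using z(1) by (rule Z1_map_closed)
  \<comment> \<open>The factor \<open>bdry Y f\<close> of \<open>g\<close> is absorbed into the
    first component, so that the second component \<open>e' k\<close> visibly comes from
    \<open>X\<close>.\<close>
  then obtain b where b: "b \<in> cmaps T (src Y)" and "Z1_act \<Gamma> Y c (Z1_map z) = Z1_act \<Gamma> Y (b, e' k) (Z1_map z)"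
    using Y.Z1_act_bdry [OF _ a f, of _ _ "e' k"] unfolding c_eq g by (metis surj_pair e'.hom_closed k)
  with eq have eq: "Z1_map z' = Z1_act \<Gamma> Y (b, e' k) (Z1_map z)" by simp
  have b_closed [simp]: "b \<sigma> \<in> carrier (src Y)" if "\<sigma> \<in> carrier \<Gamma>" for \<sigma>
    using that cmaps_closed [OF b] by (simp add: X.src.topspace_eq)
  \<comment> \<open>Solving the \<psi>-component of \<open>eq\<close> for the boundary of
    \<open>b\<close> gives a value of \<open>e'\<close>, which is exactly what lifting
    \<open>b\<close> requires.\<close>
  have bdry_b: "bdry Y (b \<sigma>) =
      e' (k \<otimes>\<^bsub>tgt X\<^esub> \<psi>' \<sigma> \<otimes>\<^bsub>tgt X\<^esub> inv\<^bsub>tgt X\<^esub> (tact X \<sigma> k) \<otimes>\<^bsub>tgt X\<^esub> inv\<^bsub>tgt X\<^esub> (\<psi> \<sigma>))"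
    if "\<sigma> \<in> carrier \<Gamma>" for \<sigma>
  proof -
    have "compose (carrier \<Gamma>) e' \<psi>' \<sigma> = snd (Z1_act \<Gamma> Y (b, e' k) (Z1_map z)) \<sigma>"
      using eq by (simp add: Z1_map_def prod_eq_iff)
    then have "e' (\<psi>' \<sigma>) = inv\<^bsub>tgt Y\<^esub> (e' k) \<otimes>\<^bsub>tgt Y\<^esub> bdry Y (b \<sigma>) \<otimes>\<^bsub>tgt Y\<^esub> e' (\<psi> \<sigma>) \<otimes>\<^bsub>tgt Y\<^esub> tact Y \<sigma> (e' k)"
      using that by (simp add: Z1_map_def Z1_act_def compose_def)
    then show ?thesis
      using that by (simp add: Y.H.word_simps tgt_equivariant)
  qed
  define \<theta> where "\<theta> = (\<lambda>\<sigma>\<in>carrier \<Gamma>.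
    lift (k \<otimes>\<^bsub>tgt X\<^esub> \<psi>' \<sigma> \<otimes>\<^bsub>tgt X\<^esub> inv\<^bsub>tgt X\<^esub> (tact X \<sigma> k) \<otimes>\<^bsub>tgt X\<^esub> inv\<^bsub>tgt X\<^esub> (\<psi> \<sigma>)) (b \<sigma>))"
  have \<theta> [simp]: "\<theta> \<sigma> \<in> carrier (src X)" "e (\<theta> \<sigma>) = b \<sigma>"
    "bdry X (\<theta> \<sigma>) = k \<otimes>\<^bsub>tgt X\<^esub> \<psi>' \<sigma> \<otimes>\<^bsub>tgt X\<^esub> inv\<^bsub>tgt X\<^esub> (tact X \<sigma> k) \<otimes>\<^bsub>tgt X\<^esub> inv\<^bsub>tgt X\<^esub> (\<psi> \<sigma>)"
    if "\<sigma> \<in> carrier \<Gamma>" for \<sigma>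
    using lift [OF _ _ bdry_b] that by (simp_all add: \<theta>_def)
  have "\<theta> \<in> cmaps T (src X)"
  proof (rule cmapsI)
    fix \<sigma> assume \<sigma>: "\<sigma> \<in> topspace T"
    then show "\<theta> \<sigma> \<in> carrier (src X)"
      by (simp add: X.src.topspace_eq)
    have \<psi>: "\<psi> \<in> cmaps T (tgt X)" "\<psi>' \<in> cmaps T (tgt X)"
      using z by (simp_all add: Z1_def)
    have "\<forall>\<^sub>F \<tau> in nhdsin T \<sigma>. tact X \<tau> k = tact X \<sigma> k"
      using X.tgt.eventually_act [of T "\<lambda>\<sigma>. \<sigma>" \<sigma> "\<lambda>\<sigma>. k"] \<sigma> by simp
    with cmaps_eventually [OF b \<sigma>] cmaps_eventually [OF \<psi>(1) \<sigma>] cmaps_eventually [OF \<psi>(2) \<sigma>]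
      X.src.eventually_in_carrier [of \<sigma>]
    show "\<forall>\<^sub>F \<tau> in nhdsin T \<sigma>. \<theta> \<tau> = \<theta> \<sigma>"
      by eventually_elim (use \<sigma> in \<open>simp add: \<theta>_def X.src.topspace_eq\<close>)
  qed (simp add: \<theta>_def X.src.topspace_eq)
  then have d: "(\<theta>, k) \<in> carrier (C0 \<Gamma> T X)"
    by (simp add: C0_def)
  have "z' = Z1_act \<Gamma> X (\<theta>, k) z"
  \<comment> \<open>Only the images under \<open>Z1_map\<close> and the \<psi>-components are left
    to compare; the latter agree by the choice of the boundary of \<theta>.\<close>
  proof (rule Z1_eqI [symmetric, OF right_action.act_closed [OF X.Z1_right_action d z(1)] z(2)])
    have "compose (carrier \<Gamma>) e \<theta> = b"
      using cmaps_extensional [OF b] by (auto simp: compose_def fun_eq_iff extensional_def X.src.topspace_eq)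
    then show "Z1_map (Z1_act \<Gamma> X (\<theta>, k) z) = Z1_map z'"
      using Z1_map_act [OF d z(1)] eq by (simp add: Z0_map_def)
    have "\<psi>' \<in> extensional (carrier \<Gamma>)"
      using z(2) X.Z1_extensional by simp
    then show "snd (Z1_act \<Gamma> X (\<theta>, k) z) = snd z'"
      by (auto simp: Z1_act_def fun_eq_iff extensional_def X.H.word_simps)
  qed
  with d show ?thesis by blast
qed

lemma Z1_map_surj:
  assumes w: "w \<in> Z1 \<Gamma> T Y"
  shows "\<exists>c\<in>carrier (C0 \<Gamma> T Y). \<exists>z\<in>Z1 \<Gamma> T X. Z1_map z = Z1_act \<Gamma> Y c w"
proof -
  obtain h \<psi> where w_eq: "w = (h, \<psi>)" by (cases w)
  note [simp] = Y.Z1_closed [OF w [unfolded w_eq]]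
  have \<psi>: "\<psi> \<in> cmaps T (tgt Y)"
    using w by (simp add: w_eq Z1_def)
  \<comment> \<open>The decomposition is chosen once for each element of \<open>tgt Y\<close>, not
    for each \<sigma>, so that its composite with \<psi> is locally constant.\<close>
  have "\<forall>g\<in>carrier (tgt Y). \<exists>r. fst r \<in> carrier (src Y) \<and> snd r \<in> carrier (tgt X) \<and>
      g = bdry Y (fst r) \<otimes>\<^bsub>tgt Y\<^esub> e' (snd r)"
  proof
    fix g assume "g \<in> carrier (tgt Y)"
    then obtain f k where "f \<in> carrier (src Y)" "k \<in> carrier (tgt X)" "g = bdry Y f \<otimes>\<^bsub>tgt Y\<^esub> e' k"
      by (rule tgt_decomp)
    then show "\<exists>r. fst r \<in> carrier (src Y) \<and> snd r \<in> carrier (tgt X) \<and>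
        g = bdry Y (fst r) \<otimes>\<^bsub>tgt Y\<^esub> e' (snd r)"
      by (intro exI [of _ "(f, k)"]) simp
  qed
  from bchoice [OF this] obtain r where r: "\<forall>g\<in>carrier (tgt Y). fst (r g) \<in> carrier (src Y) \<and>
      snd (r g) \<in> carrier (tgt X) \<and> g = bdry Y (fst (r g)) \<otimes>\<^bsub>tgt Y\<^esub> e' (snd (r g))" ..
  define p where "p g = fst (r g)" for g
  define q where "q g = snd (r g)" for g
  have p [simp]: "p g \<in> carrier (src Y)" and q [simp]: "q g \<in> carrier (tgt X)"
    and pq: "g = bdry Y (p g) \<otimes>\<^bsub>tgt Y\<^esub> e' (q g)" if "g \<in> carrier (tgt Y)" for g
    using r that by (auto simp: p_def q_def)
  \<comment> \<open>With trivial second component, acting by \<open>a\<close> multiplies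
    \<open>\<psi> \<sigma>\<close> on the left by \<open>bdry Y (a \<sigma>)\<close>, which cancels
    the boundary factor and leaves \<open>e' (q (\<psi> \<sigma>))\<close>.\<close>
  define a where "a = (\<lambda>\<sigma>\<in>carrier \<Gamma>. inv\<^bsub>src Y\<^esub> (p (\<psi> \<sigma>)))"
  define \<omega> where "\<omega> = (\<lambda>\<sigma>\<in>carrier \<Gamma>. q (\<psi> \<sigma>))"
  have \<omega>_closed [simp]: "\<omega> \<sigma> \<in> carrier (tgt X)" if "\<sigma> \<in> carrier \<Gamma>" for \<sigma>
    using that by (simp add: \<omega>_def)
  have "a \<in> cmaps T (src Y)"
    using cmaps_compose [OF \<psi>, of "\<lambda>g. inv\<^bsub>src Y\<^esub> (p g)" "src Y"]
    by (simp add: a_def compose_def X.src.topspace_eq)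
  then have c: "(a, \<one>\<^bsub>tgt Y\<^esub>) \<in> carrier (C0 \<Gamma> T Y)"
    by (simp add: C0_def)
  have \<omega>: "\<omega> \<in> cmaps T (tgt X)"
    using cmaps_compose [OF \<psi>, of q "tgt X"] by (simp add: \<omega>_def compose_def X.src.topspace_eq)
  have "inv\<^bsub>tgt Y\<^esub> (bdry Y (p g)) \<otimes>\<^bsub>tgt Y\<^esub> g = e' (q g)" if "g \<in> carrier (tgt Y)" for g
    using that by (subst (2) pq) (simp_all add: Y.H.word_simps)
  then obtain h' where act: "Z1_act \<Gamma> Y (a, \<one>\<^bsub>tgt Y\<^esub>) w = (h', compose (carrier \<Gamma>) e' \<omega>)"
    by (simp add: Z1_act_def w_eq a_def \<omega>_def compose_def cong: restrict_cong)
  have w': "(h', compose (carrier \<Gamma>) e' \<omega>) \<in> Z1 \<Gamma> T Y"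
    using right_action.act_closed [OF Y.Z1_right_action c w] by (simp add: act)
  have h'_closed [simp]: "h' (\<sigma>, \<tau>) \<in> carrier (src Y)" if "\<sigma> \<in> carrier \<Gamma>" "\<tau> \<in> carrier \<Gamma>" for \<sigma> \<tau>
    using Y.Z1_closed(2) [OF w'] that by simp
  have h': "h' \<in> cmaps (prod_topology T T) (src Y)"
    and coc: "\<And>\<sigma> \<tau> \<upsilon>. \<lbrakk>\<sigma> \<in> carrier \<Gamma>; \<tau> \<in> carrier \<Gamma>; \<upsilon> \<in> carrier \<Gamma>\<rbrakk> \<Longrightarrow>
      h' (\<sigma>, \<tau> \<otimes>\<^bsub>\<Gamma>\<^esub> \<upsilon>) \<otimes>\<^bsub>src Y\<^esub> xact Y (e' (\<omega> \<sigma>)) (sact Y \<sigma> (h' (\<tau>, \<upsilon>))) =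
      h' (\<sigma> \<otimes>\<^bsub>\<Gamma>\<^esub> \<tau>, \<upsilon>) \<otimes>\<^bsub>src Y\<^esub> h' (\<sigma>, \<tau>)"
    using w' by (auto simp: Z1_def compose_def)
  have bdry_h': "bdry Y (h' (\<sigma>, \<tau>)) =
      e' (\<omega> (\<sigma> \<otimes>\<^bsub>\<Gamma>\<^esub> \<tau>) \<otimes>\<^bsub>tgt X\<^esub> inv\<^bsub>tgt X\<^esub> (tact X \<sigma> (\<omega> \<tau>)) \<otimes>\<^bsub>tgt X\<^esub> inv\<^bsub>tgt X\<^esub> (\<omega> \<sigma>))"
    if "\<sigma> \<in> carrier \<Gamma>" "\<tau> \<in> carrier \<Gamma>" for \<sigma> \<tau>
    using Y.Z1_bdry [OF w' that] that by (simp add: compose_def tgt_equivariant)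
  \<comment> \<open>The boundary is the one that \<open>Z1_bdry\<close> forces on a cocycle with
    second component \<omega>; \<open>bdry_h'\<close> says that \<open>h'\<close> lies over
    it.\<close>
  define \<theta> where "\<theta> = (\<lambda>(\<sigma>, \<tau>)\<in>carrier \<Gamma> \<times> carrier \<Gamma>.
    lift (\<omega> (\<sigma> \<otimes>\<^bsub>\<Gamma>\<^esub> \<tau>) \<otimes>\<^bsub>tgt X\<^esub> inv\<^bsub>tgt X\<^esub> (tact X \<sigma> (\<omega> \<tau>)) \<otimes>\<^bsub>tgt X\<^esub> inv\<^bsub>tgt X\<^esub> (\<omega> \<sigma>)) (h' (\<sigma>, \<tau>)))"
  have \<theta> [simp]: "\<theta> (\<sigma>, \<tau>) \<in> carrier (src X)" "e (\<theta> (\<sigma>, \<tau>)) = h' (\<sigma>, \<tau>)"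
    "bdry X (\<theta> (\<sigma>, \<tau>)) = \<omega> (\<sigma> \<otimes>\<^bsub>\<Gamma>\<^esub> \<tau>) \<otimes>\<^bsub>tgt X\<^esub> inv\<^bsub>tgt X\<^esub> (tact X \<sigma> (\<omega> \<tau>)) \<otimes>\<^bsub>tgt X\<^esub> inv\<^bsub>tgt X\<^esub> (\<omega> \<sigma>)"
    if "\<sigma> \<in> carrier \<Gamma>" "\<tau> \<in> carrier \<Gamma>" for \<sigma> \<tau>
    using lift [OF _ _ bdry_h'] that by (simp_all add: \<theta>_def)
  have "\<theta> \<in> cmaps (prod_topology T T) (src X)"
  proof (rule cmapsI)
    fix r assume r: "r \<in> topspace (prod_topology T T)"
    then have r': "r \<in> carrier \<Gamma> \<times> carrier \<Gamma>" "fst r \<in> carrier \<Gamma>" "snd r \<in> carrier \<Gamma>"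
      by (auto simp: X.src.topspace_eq)
    then show "\<theta> r \<in> carrier (src X)"
      by (metis \<theta>(1) prod.collapse)
    note ev = X.src.eventually_pair [OF \<omega> r'(1)]
    have "\<forall>\<^sub>F q in nhdsin (prod_topology T T) r. tact X (fst q) (\<omega> (snd q)) = tact X (fst r) (\<omega> (snd r))"
      using r r' ev(2) by (intro X.tgt.eventually_act) (auto simp: continuous_map_fst)
    with ev(1) ev(3) cmaps_eventually [OF h' r] X.src.eventually_in_carrier_pair [of r]
    show "\<forall>\<^sub>F q in nhdsin (prod_topology T T) r. \<theta> q = \<theta> r"
      by eventually_elim (use r' in \<open>auto simp add: \<theta>_def\<close>)
  qed (simp add: \<theta>_def X.src.topspace_eq)
  \<comment> \<open>The boundaries of the two sides reduce to the same word in the values of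
    \<omega>, and their images under \<open>e\<close> agree by \<open>coc\<close>; uniqueness of
    lifts does the rest.\<close>
  moreover have "\<theta> (\<sigma>, \<tau> \<otimes>\<^bsub>\<Gamma>\<^esub> \<upsilon>) \<otimes>\<^bsub>src X\<^esub> xact X (\<omega> \<sigma>) (sact X \<sigma> (\<theta> (\<tau>, \<upsilon>))) =
      \<theta> (\<sigma> \<otimes>\<^bsub>\<Gamma>\<^esub> \<tau>, \<upsilon>) \<otimes>\<^bsub>src X\<^esub> \<theta> (\<sigma>, \<tau>)"
    if "\<sigma> \<in> carrier \<Gamma>" "\<tau> \<in> carrier \<Gamma>" "\<upsilon> \<in> carrier \<Gamma>" for \<sigma> \<tau> \<upsilon>
    using that
    by (intro src_eqI) (simp_all add: coc morphism_simps X.Gamma_simps X.src.m_assoc)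
  moreover have "\<omega> \<sigma> \<otimes>\<^bsub>tgt X\<^esub> tact X \<sigma> (\<omega> \<tau>) = inv\<^bsub>tgt X\<^esub> (bdry X (\<theta> (\<sigma>, \<tau>))) \<otimes>\<^bsub>tgt X\<^esub> \<omega> (\<sigma> \<otimes>\<^bsub>\<Gamma>\<^esub> \<tau>)"
    if "\<sigma> \<in> carrier \<Gamma>" "\<tau> \<in> carrier \<Gamma>" for \<sigma> \<tau>
    using that by (simp add: X.H.word_simps)
  ultimately have z: "(\<theta>, \<omega>) \<in> Z1 \<Gamma> T X"
    using \<omega> by (simp add: Z1_def)
  have "compose (carrier \<Gamma> \<times> carrier \<Gamma>) e \<theta> = h'"
    using cmaps_extensional [OF h'] by (auto simp: compose_def fun_eq_iff extensional_def X.src.topspace_eq)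
  then have "Z1_map (\<theta>, \<omega>) = Z1_act \<Gamma> Y (a, \<one>\<^bsub>tgt Y\<^esub>) w"
    by (simp add: act Z1_map_def)
  with c z show ?thesis by blast
qed

lemma bij_H1: "bij_betw (H1_map \<Gamma> T Y e e') (H1 \<Gamma> T X) (H1 \<Gamma> T Y)"
proof -
  have "H1_map \<Gamma> T Y e e' = (\<lambda>c. \<Union>z\<in>c. orbit (C0 \<Gamma> T Y) (Z1_act \<Gamma> Y) (Z1_map z))"
    by (simp add: H1_map_def Z1_map_def fun_eq_iff case_prod_unfold)
  moreover have "Z0_map c \<in> carrier (C0 \<Gamma> T Y)" if "c \<in> carrier (C0 \<Gamma> T X)" for c
    using that by (auto simp: Z0_map_def C0_def cmaps_compose_src)
  moreover have "Z1_map (Z1_act \<Gamma> X c z) = Z1_act \<Gamma> Y (Z0_map c) (Z1_map z)"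
    if "c \<in> carrier (C0 \<Gamma> T X)" "z \<in> Z1 \<Gamma> T X" for c z
    using that Z1_map_act by (cases c) simp
  ultimately show ?thesis
    unfolding H1_def
    using bij_betw_orbits [OF X.Z1_right_action Y.Z1_right_action, of Z0_map Z1_map]
      Z1_map_closed Z1_map_inj Z1_map_surj by simp
qed

end

theorem theorem3p3:
  fixes \<Gamma> :: "'s monoid" and T :: "'s topology"
    and X\<^sub>1 :: "('s, 'f1, 'g1) xmod" and X\<^sub>2 :: "('s, 'f2, 'g2) xmod"
    and e :: "'f1 \<Rightarrow> 'f2" and e' :: "'g1 \<Rightarrow> 'g2"
  assumes "profinite_group \<Gamma> T"
    and "Gamma_xmod_quasi_iso \<Gamma> T X\<^sub>1 X\<^sub>2 e e'"
  shows "bij_betw e (Hm1 \<Gamma> X\<^sub>1) (Hm1 \<Gamma> X\<^sub>2)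
    \<and> bij_betw (H0_map \<Gamma> X\<^sub>2 e e') (H0 \<Gamma> T X\<^sub>1) (H0 \<Gamma> T X\<^sub>2)
    \<and> bij_betw (H1_map \<Gamma> T X\<^sub>2 e e') (H1 \<Gamma> T X\<^sub>1) (H1 \<Gamma> T X\<^sub>2)"
  using assms(2) Gamma_xmod_quasi_iso.bij_Hm1 Gamma_xmod_quasi_iso.bij_H0
    Gamma_xmod_quasi_iso.bij_H1 by blast

end
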